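(* Let $G$ be a connected graph with exactly $m$ edges, and suppose $G$ is not a $4$-cycle. Then \[\iota(G,\mathcal{C}') \le \frac{m+1}{6}.\] Moreover: (i) equality $\iota(G,\mathcal{C}') = \frac{m+1}{6}$ holds if and only if $G$ is a pure $(m,C_4)$-special graph or $G$ is isomorphic to the diamond graph $C_4'$ or to the $5$-cycle $C_5$; (ii) if $G$ is an $(m,C_4)$-special graph, then $\iota(G,\mathcal{C}') = \lfloor (m+1)/6 \rfloor$.
   Context: All graphs are finite and simple. For a graph $G$ and $v\in V(G)$, $N[v]$ is the closed neighbourhood of $v$; for $D\subseteq V(G)$, $N[D]=\bigcup_{v\in D}N[v]$. For a set $\mathcal{F}$ of graphs, an $\mathcal{F}$-graph is a graph isomorphic to a member of $\mathcal{F}$. A set $D\subseteq V(G)$ is an $\mathcal{F}$-isolating set of $G$ if $G-N[D]$ contains no $\mathcal{F}$-graph as a subgraph (equivalently, $N[D]$ meets the vertex set of every $\mathcal{F}$-graph contained in $G$); $\iota(G,\mathcal{F})$ is the minimum size of an $\mathcal{F}$-isolating set of $G$. $\mathcal{C}'$ denotes the set of all cycles of length at least $4$. $C_n$ is the $n$-cycle; the diamond graph $C_4'$ is the graph on $\{1,2,3,4\}$ with edges $12,23,34,41,13$. $(m,C_4)$-special graphs: let $m\ge 0$ and write $m+1 = 6q + r$ with integers $q\ge 0$, $0\le r\le 5$. If $q=0$, an $(m,C_4)$-special graph is any connected $m$-edge graph (it has no $C_4$-constituents). If $q\ge 1$: take distinct vertices $v_1,\dots,v_q$, and vertex-disjoint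 $4$-cycles $F_1,\dots,F_q$ (also disjoint from $\{v_1,\dots,v_q\}$); for each $i$ choose $w_i\in V(F_i)$ and let $G_i$ be the graph with vertex set $\{v_i\}\cup V(F_i)$ and edge set $E(F_i)\cup\{v_iw_i\}$. Let $T$ be any tree with vertex set $\{v_1,\dots,v_q\}$, and let $T'$ be any connected graph with exactly $r$ edges such that $V(T')\cap\bigcup_{i=1}^q V(G_i)=\{v_q\}$. The graph $G$ with $V(G)=V(T')\cup\bigcup_i V(G_i)$ and $E(G)=E(T)\cup E(T')\cup\bigcup_i E(G_i)$ is an $(m,C_4)$-special graph (a connected $m$-edge graph); the $G_i$ are its $C_4$-constituents, $T'$ is its remainder graph. It is pure if its remainder graph has no edges. *)

theory Defs
  imports Complex_Main
begin

record 'a ugraph =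
  verts :: "'a set"
  edges :: "'a set set"

definition simple_graph :: "'a ugraph \<Rightarrow> bool" where
  "simple_graph G \<longleftrightarrow>
     finite (verts G) \<and> (\<forall>e\<in>edges G. e \<subseteq> verts G \<and> card e = 2)"

definition subgraph_of :: "'a ugraph \<Rightarrow> 'a ugraph \<Rightarrow> bool" where
  "subgraph_of H G \<longleftrightarrow>
     simple_graph H \<and> verts H \<subseteq> verts G \<and> edges H \<subseteq> edges G"

definition delete_verts :: "'a ugraph \<Rightarrow> 'a set \<Rightarrow> 'a ugraph" where
  "delete_verts G X =
     \<lparr>verts = verts G - X, edges = {e \<in> edges G. e \<inter> X = {}}\<rparr>"

definition graph_iso :: "'a ugraph \<Rightarrow> 'b ugraph \<Rightarrow> bool" where
  "graph_iso G H \<longleftrightarrow>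
     (\<exists>f. bij_betw f (verts G) (verts H) \<and>
        (\<forall>u\<in>verts G. \<forall>v\<in>verts G. {u, v} \<in> edges G \<longleftrightarrow> {f u, f v} \<in> edges H))"

definition connected_graph :: "'a ugraph \<Rightarrow> bool" where
  "connected_graph G \<longleftrightarrow>
     verts G \<noteq> {} \<and>
     (\<forall>u\<in>verts G. \<forall>v\<in>verts G. (u, v) \<in> {(x, y). {x, y} \<in> edges G}\<^sup>*)"

definition closed_nbhd :: "'a ugraph \<Rightarrow> 'a \<Rightarrow> 'a set" where
  "closed_nbhd G v = {v} \<union> {u. {v, u} \<in> edges G}"

definition closed_nbhd_set :: "'a ugraph \<Rightarrow> 'a set \<Rightarrow> 'a set" where
  "closed_nbhd_set G D = (\<Union>v\<in>D. closed_nbhd G v)"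

text \<open>The family \<open>F\<close> may live on a vertex type different from that of the graph under
  consideration, since only isomorphism with its members matters.\<close>

definition contains_family :: "'b ugraph set \<Rightarrow> 'a ugraph \<Rightarrow> bool" where
  "contains_family F G \<longleftrightarrow> (\<exists>H. subgraph_of H G \<and> (\<exists>K\<in>F. graph_iso H K))"

definition isolating_set :: "'a ugraph \<Rightarrow> 'b ugraph set \<Rightarrow> 'a set \<Rightarrow> bool" where
  "isolating_set G F D \<longleftrightarrow>
     D \<subseteq> verts G \<and> \<not> contains_family F (delete_verts G (closed_nbhd_set G D))"

definition isolation_number :: "'a ugraph \<Rightarrow> 'b ugraph set \<Rightarrow> nat" where
  "isolation_number G F = (LEAST k. \<exists>D. isolating_set G F D \<and> card D = k)"

text \<open>Only meaningful for \<open>n \<ge> 3\<close>.\<close>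

definition cycle_graph :: "nat \<Rightarrow> nat ugraph" where
  "cycle_graph n =
     \<lparr>verts = {1..n}, edges = {{i, i + 1} | i. 1 \<le> i \<and> i < n} \<union> {{n, 1}}\<rparr>"

definition long_cycles :: "nat ugraph set" where
  "long_cycles = {cycle_graph n | n. n \<ge> 4}"

definition diamond_graph :: "nat ugraph" where
  "diamond_graph =
     \<lparr>verts = {1, 2, 3, 4}, edges = {{1, 2}, {2, 3}, {3, 4}, {4, 1}, {1, 3}}\<rparr>"

definition tree :: "'a ugraph \<Rightarrow> bool" where
  "tree T \<longleftrightarrow>
     simple_graph T \<and> connected_graph T \<and>
     \<not> contains_family {cycle_graph n | n. n \<ge> 3} T"

definition constituent :: "'a \<Rightarrow> 'a ugraph \<Rightarrow> 'a \<Rightarrow> 'a ugraph" where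
  "constituent v F w =
     \<lparr>verts = {v} \<union> verts F, edges = edges F \<union> {{v, w}}\<rparr>"

text \<open>\<open>special_decomposition q r G v F w T T'\<close> says that \<open>G\<close> is the graph built from
  the data \<open>v\<^sub>i\<close>, \<open>F\<^sub>i\<close>, \<open>w\<^sub>i\<close> (\<open>1 \<le> i \<le> q\<close>), the tree \<open>T\<close> on the \<open>v\<^sub>i\<close>, and the remainder
  graph \<open>T'\<close>.\<close>

definition special_decomposition ::
  "nat \<Rightarrow> nat \<Rightarrow> 'a ugraph \<Rightarrow> (nat \<Rightarrow> 'a) \<Rightarrow> (nat \<Rightarrow> 'a ugraph) \<Rightarrow> (nat \<Rightarrow> 'a) \<Rightarrow>
   'a ugraph \<Rightarrow> 'a ugraph \<Rightarrow> bool" where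
  "special_decomposition q r G v F w T T' \<longleftrightarrow>
     q \<ge> 1 \<and>
     inj_on v {1..q} \<and>
     (\<forall>i\<in>{1..q}. simple_graph (F i) \<and> graph_iso (F i) (cycle_graph 4) \<and>
        verts (F i) \<inter> v ` {1..q} = {} \<and> w i \<in> verts (F i)) \<and>
     (\<forall>i\<in>{1..q}. \<forall>j\<in>{1..q}. i \<noteq> j \<longrightarrow> verts (F i) \<inter> verts (F j) = {}) \<and>
     tree T \<and> verts T = v ` {1..q} \<and>
     simple_graph T' \<and> connected_graph T' \<and> card (edges T') = r \<and>
     verts T' \<inter> (\<Union>i\<in>{1..q}. verts (constituent (v i) (F i) (w i))) = {v q} \<and>
     verts G = verts T' \<union> (\<Union>i\<in>{1..q}. verts (constituent (v i) (F i) (w i))) \<and>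
     edges G = edges T \<union> edges T' \<union> (\<Union>i\<in>{1..q}. edges (constituent (v i) (F i) (w i)))"

definition C4_special :: "nat \<Rightarrow> 'a ugraph \<Rightarrow> bool" where
  "C4_special m G \<longleftrightarrow>
     (let q = (m + 1) div 6; r = (m + 1) mod 6 in
      if q = 0 then simple_graph G \<and> connected_graph G \<and> card (edges G) = m
      else \<exists>v F w T T'. special_decomposition q r G v F w T T')"

text \<open>A special graph without constituents (\<open>m + 1 < 6\<close>) has no remainder graph in the sense
  of the construction, hence is not pure.\<close>

definition pure_C4_special :: "nat \<Rightarrow> 'a ugraph \<Rightarrow> bool" where
  "pure_C4_special m G \<longleftrightarrow>
     (\<exists>v F w T T'.
        special_decomposition ((m + 1) div 6) ((m + 1) mod 6) G v F w T T' \<and> edges T' = {})"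

end

theory Submission
  imports Defs
begin

text \<open>Strong induction on the number of vertices of a connected induced subgraph \<open>S\<close>, assigning cost
  \<open>6\<close> to every chosen vertex and comparing it with the number \<open>m S\<close> of edges. The claim is that
  \<open>S\<close> is a \<open>4\<close>-cycle, or has an isolating set of cost at most \<open>m S\<close>, or is extremal; in the last
  case every vertex of \<open>S\<close> lies in an isolating set of cost \<open>m S + 1\<close>.

  If \<open>S\<close> has a bridge, the two sides are treated separately, since a cycle never uses a bridge. Two
  extremal sides either are pure special graphs joined at their tree vertices, hence form a pure
  special graph, or one vertex can be saved; a \<open>4\<close>-cycle hanging on a bridge is paid for by the
  vertex \<open>y\<close> at the other end of the bridge, which is chosen and deleted.

  If \<open>S\<close> has no bridge, an induced \<open>4\<close>-cycle with exactly two outgoing edges can be split off. So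
  assume that there is none, take a vertex \<open>v\<close> of maximum degree \<open>k\<close>, choose it and delete its closed
  neighbourhood. Every component of the rest has at least two edges to the neighbours of \<open>v\<close>, at
  least three if it is a \<open>4\<close>-cycle, and therefore saves at least one edge; counting edges settles
  \<open>k \<ge> 4\<close>. For \<open>k = 3\<close> the few tight configurations are isolated without using \<open>v\<close>, and for
  \<open>k \<le> 2\<close> the graph is a path or a cycle.

  The lower bound holds because an isolating set meets every constituent of a special graph.\<close>

section \<open>Cycle graphs and isomorphisms\<close>

text \<open>The bound is tight up to a single edge while one chosen vertex costs 6, so every cut has
  to be accounted for exactly. Compared with its number of edges, a component overspends by nothing
  if it has \<open>slack\<close>, by 1 if it is \<open>extremal\<close> and by 2 if it is a 4-cycle;
  its links to the rest must make up for this. One link leaves no gain for an extremal part and is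
  too little for a 4-cycle, and two links leave no gain for a 4-cycle. This is why bridges and
  4-cycles with two outgoing edges are removed before the counting. With A the set of the k
  neighbours of v, absence of slack gives k + a + s <= 5, where a counts the edges inside A and s is
  the total gain. A component has at most gain + 2 <= 3 gain links, and every vertex of A has a
  second edge, so k <= 2a + 3s <= 3(5 - k), whence k <= 3. Prescribing a vertex of an extremal part
  matters at its links: a chosen end of a link dominates the other end and so destroys that link for
  every cycle still to be met.\<close>

definition cyc_suc :: "nat \<Rightarrow> nat \<Rightarrow> nat" where
  "cyc_suc n t = (if t = n then 1 else t + 1)"

text \<open>The closing edge \<open>{n, 1}\<close> is put on the same footing as the others, so that
  arguments along a cycle need no separate case for it.\<close>

lemma cycle_graph_edges:
  assumes "n \<ge> 1"
  shows "edges (cycle_graph n) = (\<lambda>t. {t, cyc_suc n t}) ` {1..n}"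
proof -
  have "{{i, i + 1} | i. 1 \<le> i \<and> i < n} = (\<lambda>t. {t, cyc_suc n t}) ` {1..<n}"
    by (force simp: cyc_suc_def image_iff)
  moreover have "{1..n} = insert n {1..<n}" using assms by auto
  ultimately show ?thesis by (simp add: cycle_graph_def cyc_suc_def)
qed

lemma cycle_graph_verts [simp]: "verts (cycle_graph n) = {1..n}"
  by (simp add: cycle_graph_def)

lemma simple_cycle_graph:
  assumes "n \<ge> 3"
  shows "simple_graph (cycle_graph n)"
proof -
  have "card {t, cyc_suc n t} = 2" "{t, cyc_suc n t} \<subseteq> {1..n}" if "t \<in> {1..n}" for t
    using that assms by (auto simp: cyc_suc_def card_2_iff)
  thus ?thesis using assms by (auto simp: simple_graph_def cycle_graph_edges)
qed

lemma card_cycle_graph_edges: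
  assumes "n \<ge> 3"
  shows "card (edges (cycle_graph n)) = n"
proof -
  have "inj_on (\<lambda>t. {t, cyc_suc n t}) {1..n}"
    using assms by (auto simp: inj_on_def cyc_suc_def doubleton_eq_iff split: if_splits)
  thus ?thesis using assms by (simp add: cycle_graph_edges card_image)
qed

text \<open>If \<open>P\<close> never switched off, it would spread from \<open>i\<close> up to
  \<open>n\<close>, wrap around to 1 and climb to \<open>j\<close>.\<close>

lemma cyc_suc_switch:
  assumes "i \<in> {1..n}" "j \<in> {1..n}" "P i" "\<not> P j"
  shows "\<exists>t\<in>{1..n}. P t \<and> \<not> P (cyc_suc n t)"
proof (rule ccontr)
  assume "\<not> ?thesis"
  hence step: "P t \<Longrightarrow> 1 \<le> t \<Longrightarrow> t \<le> n \<Longrightarrow> P (cyc_suc n t)" for t by auto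
  have up: "s \<le> n \<longrightarrow> P s" if "s \<ge> t" "P t" "1 \<le> t" for s t
    using that
  proof (induction s rule: dec_induct)
    case (step m)
    thus ?case using \<open>\<And>t. P t \<Longrightarrow> 1 \<le> t \<Longrightarrow> t \<le> n \<Longrightarrow> P (cyc_suc n t)\<close>[of m]
      by (auto simp: cyc_suc_def)
  qed simp
  have "P n" using up[of i n] assms by auto
  hence "P 1" using step[of n] assms by (auto simp: cyc_suc_def)
  hence "P j" using up[of 1 j] assms by auto
  thus False using assms by simp
qed

lemma edge_doubleton:
  assumes "simple_graph K" "e \<in> edges K"
  obtains a b where "e = {a, b}" "a \<noteq> b" "a \<in> verts K" "b \<in> verts K"
proof -
  have "card e = 2" "e \<subseteq> verts K" using assms by (auto simp: simple_graph_def)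
  then obtain a b where "e = {a, b}" "a \<noteq> b" by (meson card_2_iff)
  thus ?thesis using that \<open>e \<subseteq> verts K\<close> by simp
qed

lemma graph_iso_card_edges:
  assumes "simple_graph K" "simple_graph L" "graph_iso K L"
  shows "card (edges K) = card (edges L)"
proof -
  obtain f where f: "bij_betw f (verts K) (verts L)"
    and e: "\<And>u v. u \<in> verts K \<Longrightarrow> v \<in> verts K \<Longrightarrow> {u, v} \<in> edges K \<longleftrightarrow> {f u, f v} \<in> edges L"
    using assms(3) by (auto simp: graph_iso_def)
  have sub: "edges K \<subseteq> Pow (verts K)" using assms(1) by (auto simp: simple_graph_def)
  have "inj_on ((`) f) (edges K)"
    using f sub by (meson bij_betw_def inj_on_image_Pow inj_on_subset)
  moreover have "(`) f ` edges K = edges L"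
  proof
    show "(`) f ` edges K \<subseteq> edges L"
    proof clarify
      fix x assume x: "x \<in> edges K"
      obtain a b where "x = {a, b}" "a \<in> verts K" "b \<in> verts K"
        using edge_doubleton[OF assms(1) x] by metis
      thus "f ` x \<in> edges L" using e[of a b] x by simp
    qed
    show "edges L \<subseteq> (`) f ` edges K"
    proof
      fix y assume y: "y \<in> edges L"
      then obtain a b where ab: "y = {a, b}" "a \<in> verts L" "b \<in> verts L"
        using edge_doubleton[OF assms(2)] by metis
      then obtain u v where "u \<in> verts K" "v \<in> verts K" "a = f u" "b = f v"
        using f unfolding bij_betw_def by blast
      thus "y \<in> (`) f ` edges K" using e[of u v] ab y by (auto intro!: image_eqI[of _ _ "{u, v}"])
    qed
  qed
  ultimately show ?thesis by (metis card_image)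
qed

lemma graph_iso_card_verts: "graph_iso K L \<Longrightarrow> card (verts K) = card (verts L)"
  by (auto simp: graph_iso_def bij_betw_same_card)

text \<open>\<open>graph_iso\<close> maps into the concrete graph; the reverse direction names the
  vertices of an abstract copy \<open>g 1\<close>, \<open>g 2\<close>, and so on, as the case
  analyses require.\<close>

lemma graph_iso_inverse:
  assumes "graph_iso K L"
  obtains g where "bij_betw g (verts L) (verts K)"
    "\<And>i j. i \<in> verts L \<Longrightarrow> j \<in> verts L \<Longrightarrow> {g i, g j} \<in> edges K \<longleftrightarrow> {i, j} \<in> edges L"
proof -
  obtain f where f: "bij_betw f (verts K) (verts L)"
    and e: "\<And>u v. u \<in> verts K \<Longrightarrow> v \<in> verts K \<Longrightarrow> {u, v} \<in> edges K \<longleftrightarrow> {f u, f v} \<in> edges L"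
    using assms by (auto simp: graph_iso_def)
  show ?thesis
  proof
    show "bij_betw (inv_into (verts K) f) (verts L) (verts K)"
      using f by (rule bij_betw_inv_into)
    fix i j assume ij: "i \<in> verts L" "j \<in> verts L"
    have "inv_into (verts K) f i \<in> verts K" "inv_into (verts K) f j \<in> verts K"
      using ij f by (auto simp: bij_betw_def intro!: inv_into_into)
    thus "{inv_into (verts K) f i, inv_into (verts K) f j} \<in> edges K \<longleftrightarrow> {i, j} \<in> edges L"
      using e ij f by (simp add: bij_betw_inv_into_right)
  qed
qed

lemma cycle_graph_4: "edges (cycle_graph 4) = {{1, 2}, {2, 3}, {3, 4}, {4, 1}}"
proof -
  have "{1..4::nat} = {1, 2, 3, 4}" by auto
  thus ?thesis by (simp add: cycle_graph_edges cyc_suc_def eval_nat_numeral)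
qed

lemma cycle_graph_5: "edges (cycle_graph 5) = {{1, 2}, {2, 3}, {3, 4}, {4, 5}, {5, 1}}"
proof -
  have "{1..5::nat} = {1, 2, 3, 4, 5}" by auto
  thus ?thesis by (simp add: cycle_graph_edges cyc_suc_def eval_nat_numeral)
qed

lemma simple_diamond_graph: "simple_graph diamond_graph"
  and card_diamond_graph_edges: "card (edges diamond_graph) = 5"
  and card_diamond_graph_verts: "card (verts diamond_graph) = 4"
  by (auto simp: simple_graph_def diamond_graph_def card_insert_if doubleton_eq_iff)

lemma two_le_cardI: "finite A \<Longrightarrow> a \<in> A \<Longrightarrow> b \<in> A \<Longrightarrow> a \<noteq> b \<Longrightarrow> 2 \<le> card A"
  using card_mono[of A "{a, b}"] by auto

section \<open>Cuts, cycles and components\<close>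

locale fin_graph =
  fixes G :: "'a ugraph"
  assumes simple: "simple_graph G"
begin

text \<open>All subgraphs below are induced, so they are represented by their vertex sets.\<close>

abbreviation V where "V \<equiv> verts G"
abbreviation E where "E \<equiv> edges G"
abbreviation N where "N \<equiv> closed_nbhd_set G"

definition edges_in :: "'a set \<Rightarrow> 'a set set" where "edges_in S = {e \<in> E. e \<subseteq> S}"

abbreviation m where "m S \<equiv> card (edges_in S)"

definition induced :: "'a set \<Rightarrow> 'a ugraph" where "induced S = \<lparr>verts = S, edges = edges_in S\<rparr>"

definition crossing :: "'a set \<Rightarrow> 'a set \<Rightarrow> 'a set set" where
  "crossing X Y = {e \<in> E. \<exists>x\<in>X. \<exists>y\<in>Y. e = {x, y}}"

text \<open>Phrased by cuts rather than by reachability, since later arguments count edges across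
  vertex partitions; the link to \<open>connected_graph\<close> is made only at the end.\<close>

definition conn :: "'a set \<Rightarrow> bool" where
  "conn S \<longleftrightarrow> S \<noteq> {} \<and> (\<forall>X. X \<subseteq> S \<longrightarrow> X \<noteq> {} \<longrightarrow> X \<noteq> S \<longrightarrow> crossing X (S - X) \<noteq> {})"

text \<open>\<open>C\<close> is the vertex set of a cycle, not necessarily induced, of length at least \<open>k\<close>.\<close>

definition cycle_set :: "nat \<Rightarrow> 'a set \<Rightarrow> bool" where
  "cycle_set k C \<longleftrightarrow> (\<exists>K n. subgraph_of K G \<and> verts K = C \<and> n \<ge> k \<and> graph_iso K (cycle_graph n))"

text \<open>\<open>N\<close> is taken in all of \<open>G\<close>. For \<open>D\<close> inside
  \<open>S\<close> this is harmless: a cycle inside \<open>S\<close> meets only the part of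
  \<open>N D\<close> inside \<open>S\<close>, which is the neighbourhood in the induced
  subgraph.\<close>

definition isolates :: "'a set \<Rightarrow> 'a set \<Rightarrow> bool" where
  "isolates S D \<longleftrightarrow> D \<subseteq> S \<and> (\<forall>C. cycle_set 4 C \<longrightarrow> C \<subseteq> S \<longrightarrow> C \<inter> N D \<noteq> {})"

text \<open>The strict bound \<open>6 \<iota> < m S + 1\<close>.\<close>

definition slack :: "'a set \<Rightarrow> bool" where
  "slack S \<longleftrightarrow> (\<exists>D. isolates S D \<and> 6 * card D \<le> m S)"

abbreviation square where "square S \<equiv> graph_iso (induced S) (cycle_graph 4)"
abbreviation diamond where "diamond S \<equiv> graph_iso (induced S) diamond_graph"
abbreviation pentagon where "pentagon S \<equiv> graph_iso (induced S) (cycle_graph 5)"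

lemma finite_V: "finite V" and edge_V: "e \<in> E \<Longrightarrow> e \<subseteq> V" and edge_2: "e \<in> E \<Longrightarrow> card e = 2"
  using simple by (auto simp: simple_graph_def)

lemma finite_E [simp]: "finite E"
  using finite_V edge_V by (meson Pow_iff finite_Pow_iff finite_subset subsetI)

lemma finite_edges_in [simp]: "finite (edges_in S)" by (simp add: edges_in_def)
lemma finite_crossing [simp]: "finite (crossing X Y)" by (simp add: crossing_def)
lemma finite_sub: "S \<subseteq> V \<Longrightarrow> finite S" using finite_V finite_subset by blast

lemma no_loop [simp]: "{x} \<notin> E" using edge_2[of "{x}"] by auto

lemma edgeE:
  assumes "e \<in> E" obtains a b where "e = {a, b}" "a \<noteq> b" "a \<in> V" "b \<in> V"
  using edge_doubleton[OF simple assms] by metis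

lemma induced_simps [simp]: "verts (induced S) = S" "edges (induced S) = edges_in S"
  by (simp_all add: induced_def)

lemma simple_induced: "S \<subseteq> V \<Longrightarrow> simple_graph (induced S)"
  using finite_sub edge_2 by (auto simp: simple_graph_def edges_in_def)

lemma N_iff: "u \<in> N D \<longleftrightarrow> u \<in> D \<or> (\<exists>d\<in>D. {d, u} \<in> E)"
  by (auto simp: closed_nbhd_set_def closed_nbhd_def)

lemma N_Un: "N (A \<union> B) = N A \<union> N B" by (auto simp: N_iff)
lemma N_mono: "A \<subseteq> B \<Longrightarrow> N A \<subseteq> N B" unfolding closed_nbhd_set_def by blast
lemma N_empty [simp]: "N {} = {}" by (auto simp: N_iff)

lemma crossing_mono: "X \<subseteq> X' \<Longrightarrow> Y \<subseteq> Y' \<Longrightarrow> crossing X Y \<subseteq> crossing X' Y'"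
  unfolding crossing_def by blast
lemma crossing_sym: "crossing X Y = crossing Y X"
  unfolding crossing_def by (auto simp: insert_commute)

lemma in_edges_in: "{x, y} \<in> edges_in S \<longleftrightarrow> {x, y} \<in> E \<and> x \<in> S \<and> y \<in> S" by (auto simp: edges_in_def)
lemma crossingI: "{x, y} \<in> E \<Longrightarrow> x \<in> X \<Longrightarrow> y \<in> Y \<Longrightarrow> {x, y} \<in> crossing X Y" by (auto simp: crossing_def)
lemma crossingE:
  assumes "e \<in> crossing X Y" obtains x y where "e = {x, y}" "x \<in> X" "y \<in> Y" "{x, y} \<in> E"
  using assms by (auto simp: crossing_def)

section \<open>How a cycle crosses a vertex cut\<close>

lemma cycle_set_mono: "cycle_set k C \<Longrightarrow> l \<le> k \<Longrightarrow> cycle_set l C"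
  unfolding cycle_set_def by (elim exE conjE, intro exI conjI) auto

lemma cycle_set_card: "cycle_set k C \<Longrightarrow> k \<le> card C"
  unfolding cycle_set_def by (elim exE conjE, drule graph_iso_card_verts) simp

lemma cycle_set_sub: "cycle_set k C \<Longrightarrow> C \<subseteq> V"
  by (auto simp: cycle_set_def subgraph_of_def)

lemma cycle_set_subset_card:
  assumes "cycle_set k C" "C \<subseteq> A" "finite A"
  shows "k \<le> card A"
  using cycle_set_card[OF assms(1)] card_mono[OF assms(3,2)] by linarith

text \<open>Once around the cycle, membership in \<open>X\<close> is lost at some step
  \<open>t\<close> and regained at some step \<open>s\<close>. The two edges are found in
  \<open>K\<close>, not merely in \<open>G\<close>, because \<open>max_degree_two\<close> has to
  identify all edges of the cycle.\<close>

lemma subgraph_cycle_cut: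
  assumes K: "graph_iso K (cycle_graph n)" "n \<ge> 3"
    and "verts K \<inter> X \<noteq> {}" "verts K - X \<noteq> {}" "edges K \<subseteq> E"
  shows "2 \<le> card (edges K \<inter> crossing (verts K \<inter> X) (verts K - X))"
proof -
  obtain g where g: "bij_betw g {1..n} (verts K)" and
    e: "\<And>i j. i \<in> {1..n} \<Longrightarrow> j \<in> {1..n} \<Longrightarrow> {g i, g j} \<in> edges K \<longleftrightarrow> {i, j} \<in> edges (cycle_graph n)"
    using graph_iso_inverse[OF K(1)] by auto
  have suc: "cyc_suc n t \<in> {1..n}" if "t \<in> {1..n}" for t
    using that by (auto simp: cyc_suc_def)
  have ge: "{g t, g (cyc_suc n t)} \<in> edges K" if "t \<in> {1..n}" for t
    using e[OF that suc[OF that]] that K(2) by (auto simp: cycle_graph_edges)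
  have ge': "{g (cyc_suc n t), g t} \<in> edges K" if "t \<in> {1..n}" for t
    using ge[OF that] by (simp add: insert_commute)
  have gK: "g ` {1..n} = verts K" using g by (simp add: bij_betw_def)
  have gv: "g t \<in> verts K" if "t \<in> {1..n}" for t using gK that by blast
  obtain i where i: "i \<in> {1..n}" "g i \<in> X" using assms(3) unfolding gK[symmetric] by blast
  obtain j where j: "j \<in> {1..n}" "g j \<notin> X" using assms(4) unfolding gK[symmetric] by blast
  obtain t where t: "t \<in> {1..n}" "g t \<in> X" "g (cyc_suc n t) \<notin> X"
    using cyc_suc_switch[of i n j "\<lambda>t. g t \<in> X"] i j by auto
  obtain s where s: "s \<in> {1..n}" "g s \<notin> X" "g (cyc_suc n s) \<in> X"
    using cyc_suc_switch[of j n i "\<lambda>t. g t \<notin> X"] i j by auto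
  have inj: "inj_on g {1..n}" using g by (simp add: bij_betw_def)
  \<comment> \<open>Coinciding edges would make \<open>s\<close> and \<open>t\<close> successors of
    each other, impossible for \<open>n \<ge> 3\<close>.\<close>
  have "{g t, g (cyc_suc n t)} \<noteq> {g s, g (cyc_suc n s)}"
  proof
    assume "{g t, g (cyc_suc n t)} = {g s, g (cyc_suc n s)}"
    hence "g t = g (cyc_suc n s)" "g s = g (cyc_suc n t)" using s t by (auto simp: doubleton_eq_iff)
    hence "t = cyc_suc n s" "s = cyc_suc n t"
      using inj_onD[OF inj] s(1) t(1) suc by blast+
    thus False using \<open>n \<ge> 3\<close> s(1) t(1) by (auto simp: cyc_suc_def split: if_splits)
  qed
  moreover have "{g t, g (cyc_suc n t)} \<in> edges K \<inter> crossing (verts K \<inter> X) (verts K - X)"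
    using ge[OF t(1)] t gv suc[OF t(1)] assms(5) by (auto intro!: crossingI)
  moreover have "{g (cyc_suc n s), g s} \<in> edges K \<inter> crossing (verts K \<inter> X) (verts K - X)"
    using ge'[OF s(1)] s(2,3) gv[OF s(1)] gv[OF suc[OF s(1)]] assms(5) by (auto intro!: crossingI)
  ultimately show ?thesis by (intro two_le_cardI) (auto simp: insert_commute)
qed

lemma cycle_set_cut:
  assumes "cycle_set 3 C" "C \<inter> X \<noteq> {}" "C - X \<noteq> {}"
  shows "2 \<le> card (crossing (C \<inter> X) (C - X))"
proof -
  obtain K n where K: "subgraph_of K G" "verts K = C" "n \<ge> 3" "graph_iso K (cycle_graph n)"
    using assms(1) by (auto simp: cycle_set_def)
  have "2 \<le> card (edges K \<inter> crossing (C \<inter> X) (C - X))"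
    using subgraph_cycle_cut[OF K(4,3), of X] assms K by (auto simp: subgraph_of_def)
  also have "\<dots> \<le> card (crossing (C \<inter> X) (C - X))" by (intro card_mono) auto
  finally show ?thesis .
qed

text \<open>The form in which cuts are mostly applied: \<open>B\<close> collects the edges that a
  cycle avoiding the dominated vertices could still use. With at most one left, it cannot get across
  and back.\<close>

lemma cycle_set_separated:
  assumes "cycle_set 3 C" "card B \<le> 1" "finite B" "crossing (C \<inter> X) (C - X) \<subseteq> B"
  shows "C \<subseteq> X \<or> C \<inter> X = {}"
proof (rule ccontr)
  assume "\<not> ?thesis"
  hence "2 \<le> card (crossing (C \<inter> X) (C - X))" by (intro cycle_set_cut[OF assms(1)]) auto
  thus False using card_mono[OF assms(3,4)] assms(2) by simp
qed

lemma cycle_set_cut_two: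
  assumes "cycle_set 3 C" "C \<inter> X \<noteq> {}" "C - X \<noteq> {}"
  obtains e f where "e \<noteq> f" "e \<in> crossing (C \<inter> X) (C - X)" "f \<in> crossing (C \<inter> X) (C - X)"
proof -
  obtain T where "T \<subseteq> crossing (C \<inter> X) (C - X)" "card T = 2"
    using cycle_set_cut[OF assms] by (meson obtain_subset_with_card_n)
  thus ?thesis using that by (auto simp: card_2_iff)
qed

lemma cycle_set_degree:
  assumes "cycle_set 3 C" "x \<in> C"
  obtains y z where "y \<noteq> z" "y \<in> C" "z \<in> C" "{x, y} \<in> E" "{x, z} \<in> E"
proof -
  have "card C \<ge> 3" using cycle_set_card assms by blast
  hence "C - {x} \<noteq> {}" using card_mono[of "{x}" C] by auto
  then obtain e f where "e \<noteq> f" "e \<in> crossing (C \<inter> {x}) (C - {x})" "f \<in> crossing (C \<inter> {x}) (C - {x})"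
    using cycle_set_cut_two[OF assms(1), of "{x}"] assms(2) by auto
  thus ?thesis using that by (elim crossingE) auto
qed

lemma conn_cut: "conn S \<Longrightarrow> X \<subseteq> S \<Longrightarrow> X \<noteq> {} \<Longrightarrow> X \<noteq> S \<Longrightarrow> \<exists>x\<in>X. \<exists>y\<in>S - X. {x, y} \<in> E"
  unfolding conn_def by (metis crossingE ex_in_conv)

section \<open>Components left by a deletion, and the edge count over them\<close>

definition components :: "'a set \<Rightarrow> 'a set set \<Rightarrow> bool" where
  "components R P \<longleftrightarrow> \<Union>P = R \<and> finite P \<and> (\<forall>H\<in>P. conn H) \<and>
     (\<forall>H\<in>P. \<forall>H'\<in>P. H \<noteq> H' \<longrightarrow> H \<inter> H' = {} \<and> crossing H H' = {})"

lemma components_Un: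
  assumes P: "components X P" and Q: "components Y Q" and "X \<inter> Y = {}" "crossing X Y = {}"
  shows "components (X \<union> Y) (P \<union> Q)"
proof -
  have cross: "H \<inter> H' = {} \<and> crossing H H' = {} \<and> crossing H' H = {}" if "H \<in> P" "H' \<in> Q" for H H'
  proof -
    have s: "H \<subseteq> X" "H' \<subseteq> Y"
      using Union_upper[OF that(1)] Union_upper[OF that(2)] P Q by (simp_all add: components_def)
    hence "crossing H H' = {}" using crossing_mono[OF s] assms(4) by simp
    thus ?thesis using s crossing_sym[of H H'] assms(3) by auto
  qed
  have "H \<inter> H' = {} \<and> crossing H H' = {}" if h: "H \<in> P \<union> Q" "H' \<in> P \<union> Q" "H \<noteq> H'" for H H'
  proof -
    consider "H \<in> P" "H' \<in> P" | "H \<in> Q" "H' \<in> Q" | "H \<in> P" "H' \<in> Q" | "H' \<in> P" "H \<in> Q"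
      using h by blast
    thus ?thesis
    proof cases
      case 1 thus ?thesis using P h(3) by (simp add: components_def)
    next
      case 2 thus ?thesis using Q h(3) by (simp add: components_def)
    next
      case 3 thus ?thesis using cross by simp
    next
      case 4 thus ?thesis using cross[OF 4] by (simp add: Int_commute)
    qed
  qed
  moreover have "\<Union>(P \<union> Q) = X \<union> Y" "finite (P \<union> Q)" "\<forall>H\<in>P \<union> Q. conn H"
    using P Q by (auto simp: components_def)
  ultimately show ?thesis unfolding components_def by simp
qed

text \<open>As long as some cut is empty, the set splits along it; a nonempty set without an empty
  cut is connected by definition.\<close>

lemma components_exist:
  assumes "finite R"
  shows "\<exists>P. components R P"
  using assms
proof (induction "card R" arbitrary: R rule: less_induct)
  case less
  consider "R = {}" | "conn R" | X where "X \<subseteq> R" "X \<noteq> {}" "X \<noteq> R" "crossing X (R - X) = {}"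
    unfolding conn_def by blast
  thus ?case
  proof cases
    case 1 thus ?thesis by (intro exI[of _ "{}"]) (auto simp: components_def)
  next
    case 2 thus ?thesis by (intro exI[of _ "{R}"]) (auto simp: components_def)
  next
    case 3
    have "R - X \<subset> R" "X \<subset> R" using 3 by auto
    hence "card X < card R" "card (R - X) < card R"
      using less.prems by (auto intro: psubset_card_mono)
    moreover have "finite X" "finite (R - X)" using 3(1) less.prems finite_subset by auto
    ultimately obtain P Q where P: "components X P" and Q: "components (R - X) Q"
      using less.hyps[of X] less.hyps[of "R - X"] by blast
    have "components (X \<union> (R - X)) (P \<union> Q)" using components_Un[OF P Q] 3 by auto
    moreover have "X \<union> (R - X) = R" using 3(1) by auto
    ultimately show ?thesis by auto
  qed
qed

lemma edges_in_Un:
  assumes "A \<inter> B = {}"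
  shows "edges_in (A \<union> B) = edges_in A \<union> edges_in B \<union> crossing A B"
proof (intro set_eqI iffI)
  fix e assume "e \<in> edges_in (A \<union> B)"
  hence e: "e \<in> E" "e \<subseteq> A \<union> B" by (auto simp: edges_in_def)
  obtain a b where ab: "e = {a, b}" using e(1) edgeE by metis
  consider "e \<subseteq> A" | "e \<subseteq> B" | "a \<in> A" "b \<in> B" | "b \<in> A" "a \<in> B" using e ab by auto
  thus "e \<in> edges_in A \<union> edges_in B \<union> crossing A B"
    by cases (use e ab in \<open>auto simp: edges_in_def crossing_def insert_commute\<close>)
qed (auto simp: edges_in_def crossing_def)

lemma card_edges_in_Un:
  assumes "A \<inter> B = {}"
  shows "m (A \<union> B) = m A + m B + card (crossing A B)"
proof -
  have "edges_in A \<inter> edges_in B = {}"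
  proof -
    have "e \<notin> edges_in B" if "e \<in> edges_in A" for e
    proof
      assume "e \<in> edges_in B"
      hence "e \<subseteq> A \<inter> B" "e \<in> E" using that by (auto simp: edges_in_def)
      thus False using assms edge_2[of e] by auto
    qed
    thus ?thesis by blast
  qed
  moreover have "(edges_in A \<union> edges_in B) \<inter> crossing A B = {}" using assms by (auto simp: edges_in_def crossing_def)
  ultimately show ?thesis unfolding edges_in_Un[OF assms] by (simp add: card_Un_disjoint)
qed

lemma edges_in_singleton [simp]: "edges_in {x} = {}"
proof -
  have "e \<notin> edges_in {x}" for e
  proof
    assume "e \<in> edges_in {x}"
    hence "e \<in> E" "e \<subseteq> {x}" by (auto simp: edges_in_def)
    thus False using edge_2[of e] card_mono[of "{x}" e] by auto
  qed
  thus ?thesis by blast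
qed

lemma component_subset: "components R P \<Longrightarrow> H \<in> P \<Longrightarrow> H \<subseteq> R"
  using Union_upper[of H P] by (simp add: components_def)

lemma component_nonempty: "components R P \<Longrightarrow> H \<in> P \<Longrightarrow> H \<noteq> {}"
  by (simp add: components_def conn_def)

lemma component_cover:
  assumes "components R P" "x \<in> R" obtains H where "H \<in> P" "x \<in> H"
  using assms by (auto simp: components_def)

lemma component_no_edge:
  assumes "components R P" "H \<in> P" "x \<in> H" "y \<in> R - H"
  shows "{x, y} \<notin> E"
proof -
  obtain H' where H': "H' \<in> P" "y \<in> H'" using assms component_cover by blast
  hence "H' \<noteq> H" using assms by auto
  hence "crossing H H' = {}" using assms H' by (simp add: components_def)
  thus ?thesis using crossingI[of x y H H'] assms H' by auto
qed

text \<open>Edges leaving a component of \<open>R\<close> can only end in \<open>X\<close>. Hence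
  cut bounds for \<open>H\<close> in the whole set become bounds on its links to the deleted
  part.\<close>

lemma component_crossing:
  assumes "components R P" "H \<in> P" "X \<inter> R = {}"
  shows "crossing H ((X \<union> R) - H) = crossing H X"
proof
  show "crossing H X \<subseteq> crossing H ((X \<union> R) - H)"
    using component_subset[OF assms(1,2)] assms(3) by (intro crossing_mono) auto
  show "crossing H ((X \<union> R) - H) \<subseteq> crossing H X"
  proof
    fix e assume "e \<in> crossing H ((X \<union> R) - H)"
    then obtain x y where e: "e = {x, y}" "x \<in> H" "y \<in> (X \<union> R) - H" "{x, y} \<in> E" by (rule crossingE)
    hence "y \<in> X" using component_no_edge[OF assms(1,2) e(2), of y] by auto
    thus "e \<in> crossing H X" using e by (simp add: crossingI)
  qed
qed

lemma m_components:
  assumes "components R P"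
  shows "m R = (\<Sum>H\<in>P. m H)"
proof -
  have "edges_in R = (\<Union>H\<in>P. edges_in H)"
  proof
    show "edges_in R \<subseteq> (\<Union>H\<in>P. edges_in H)"
    proof
      fix e assume "e \<in> edges_in R"
      hence e: "e \<in> E" "e \<subseteq> R" by (auto simp: edges_in_def)
      obtain a b where ab: "e = {a, b}" using e(1) edgeE by metis
      obtain H where H: "H \<in> P" "a \<in> H" using component_cover[OF assms, of a] e ab by auto
      have "b \<in> H" using component_no_edge[OF assms H, of b] e ab by auto
      thus "e \<in> (\<Union>H\<in>P. edges_in H)" using e ab H by (auto simp: edges_in_def)
    qed
    show "(\<Union>H\<in>P. edges_in H) \<subseteq> edges_in R" using component_subset[OF assms] by (fastforce simp: edges_in_def)
  qed
  moreover have "edges_in H \<inter> edges_in H' = {}" if "H \<in> P" "H' \<in> P" "H \<noteq> H'" for H H'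
  proof -
    have d: "H \<inter> H' = {}" using assms that by (simp add: components_def)
    have "e \<notin> edges_in H'" if "e \<in> edges_in H" for e
    proof
      assume "e \<in> edges_in H'"
      hence "e \<subseteq> H \<inter> H'" "e \<in> E" using that by (auto simp: edges_in_def)
      thus False using d edge_2[of e] by auto
    qed
    thus ?thesis by blast
  qed
  moreover have "finite P" using assms by (simp add: components_def)
  ultimately show ?thesis by (simp add: card_UN_disjoint)
qed

lemma card_crossing_components:
  assumes "components R P" "X \<inter> R = {}"
  shows "card (crossing R X) = (\<Sum>H\<in>P. card (crossing H X))"
proof -
  have "crossing R X = (\<Union>H\<in>P. crossing H X)"
    using assms(1) unfolding components_def crossing_def by auto
  moreover have "crossing H X \<inter> crossing H' X = {}" if "H \<in> P" "H' \<in> P" "H \<noteq> H'" for H H'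
  proof -
    have "H \<inter> H' = {}" "H \<subseteq> R" "H' \<subseteq> R"
      using assms that component_subset by (auto simp: components_def)
    moreover from this have "X \<inter> H = {}" "X \<inter> H' = {}" using assms(2) by auto
    ultimately show ?thesis by (auto simp: crossing_def doubleton_eq_iff dest: IntI)
  qed
  moreover have "finite P" using assms by (simp add: components_def)
  ultimately show ?thesis by (simp add: card_UN_disjoint)
qed

text \<open>The accounting identity behind the cost estimates: each edge not inside \<open>X\<close>
  is charged to exactly one component, as an inner edge or as a link.\<close>

lemma m_delete:
  assumes "components (S - X) P" "X \<subseteq> S"
  shows "m S = m X + (\<Sum>H\<in>P. m H + card (crossing H X))"
proof -
  have "m S = m (X \<union> (S - X))" using assms(2) by (simp add: Un_absorb1)
  also have "\<dots> = m X + m (S - X) + card (crossing (S - X) X)"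
    using card_edges_in_Un[of X "S - X"] by (simp add: crossing_sym)
  finally show ?thesis
    using m_components[OF assms(1)] card_crossing_components[OF assms(1), of X] by (simp add: sum.distrib)
qed

lemma cycle_set_in_component:
  assumes "components R P" "cycle_set 3 C" "C \<subseteq> R"
  obtains H where "H \<in> P" "C \<subseteq> H"
proof -
  have "C \<noteq> {}" using cycle_set_card[OF assms(2)] by auto
  then obtain c where c: "c \<in> C" by auto
  obtain H where H: "H \<in> P" "c \<in> H" using component_cover[OF assms(1)] c assms(3) by blast
  have "e \<notin> crossing (C \<inter> H) (C - H)" for e
  proof
    assume "e \<in> crossing (C \<inter> H) (C - H)"
    then obtain x y where "x \<in> C \<inter> H" "y \<in> C - H" "{x, y} \<in> E" by (rule crossingE)
    thus False using component_no_edge[OF assms(1) H(1), of x y] assms(3) by auto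
  qed
  hence "crossing (C \<inter> H) (C - H) \<subseteq> {}" by blast
  hence "C \<subseteq> H" using cycle_set_separated[OF assms(2), of "{}" H] c H(2) by auto
  thus ?thesis using that H by blast
qed

lemma isolatesD: "isolates S D \<Longrightarrow> cycle_set 4 C \<Longrightarrow> C \<subseteq> S \<Longrightarrow> C \<inter> N D \<noteq> {}" by (simp add: isolates_def)

text \<open>Choose \<open>v\<close> and delete \<open>X\<close>: the cost \<open>6\<close> of \<open>v\<close> is paid by the edges inside \<open>X\<close> and by the
  edges \<open>g H\<close> that each component \<open>H\<close> and its links to \<open>X\<close> leave unused.\<close>

lemma slack_by_gain:
  assumes "S \<subseteq> V" "v \<in> S" "X \<subseteq> N {v}" "X \<subseteq> S" "components (S - X) P"
    and H: "\<And>H. H \<in> P \<Longrightarrow> \<exists>D\<subseteq>H. (\<forall>C. cycle_set 4 C \<longrightarrow> C \<subseteq> H \<longrightarrow> C \<inter> (N D \<union> N {v}) \<noteq> {}) \<and>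
        6 * card D + g H \<le> m H + card (crossing H X)"
    and g: "6 \<le> m X + (\<Sum>H\<in>P. g H)"
  shows "slack S"
proof -
  have "\<forall>H\<in>P. \<exists>D. D \<subseteq> H \<and> (\<forall>C. cycle_set 4 C \<longrightarrow> C \<subseteq> H \<longrightarrow> C \<inter> (N D \<union> N {v}) \<noteq> {}) \<and>
        6 * card D + g H \<le> m H + card (crossing H X)" using H by (rule ballI)
  from bchoice[OF this] obtain f where f0: "\<forall>H\<in>P. f H \<subseteq> H \<and>
        (\<forall>C. cycle_set 4 C \<longrightarrow> C \<subseteq> H \<longrightarrow> C \<inter> (N (f H) \<union> N {v}) \<noteq> {}) \<and>
        6 * card (f H) + g H \<le> m H + card (crossing H X)" ..
  have f: "f H \<subseteq> H" "\<And>C. cycle_set 4 C \<Longrightarrow> C \<subseteq> H \<Longrightarrow> C \<inter> (N (f H) \<union> N {v}) \<noteq> {}"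
    "6 * card (f H) + g H \<le> m H + card (crossing H X)" if "H \<in> P" for H
    using bspec[OF f0 that] by simp_all
  define D where "D = insert v (\<Union>H\<in>P. f H)"
  have fP: "finite P" using assms(5) by (simp add: components_def)
  have "isolates S D"
    unfolding isolates_def
  proof (intro conjI allI impI)
    show "D \<subseteq> S" using assms(2) f(1) component_subset[OF assms(5)] by (fastforce simp: D_def)
    fix C assume C: "cycle_set 4 C" "C \<subseteq> S"
    have N: "N {v} \<subseteq> N D" by (rule N_mono) (simp add: D_def)
    have Nf: "N (f H) \<subseteq> N D" if "H \<in> P" for H
      by (rule N_mono) (use that in \<open>auto simp: D_def\<close>)
    show "C \<inter> N D \<noteq> {}"
    proof (cases "C \<inter> X = {}")
      case True
      then obtain H where "H \<in> P" "C \<subseteq> H"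
        using cycle_set_in_component[OF assms(5) cycle_set_mono[OF C(1)], of thesis] C(2) by auto
      thus ?thesis using f(2)[of H C] N Nf[of H] C(1) by blast
    next
      case False
      thus ?thesis using assms(3) N by blast
    qed
  qed
  moreover have "6 * card D \<le> m S"
  proof -
    have "card D \<le> Suc (card (\<Union>H\<in>P. f H))"
      unfolding D_def by (cases "finite (\<Union>H\<in>P. f H)") (simp_all add: card_insert_if)
    hence "card D \<le> 1 + (\<Sum>H\<in>P. card (f H))" using card_UN_le[OF fP, of f] by simp
    hence "6 * card D \<le> 6 + (\<Sum>H\<in>P. 6 * card (f H))" by (simp flip: sum_distrib_left)
    also have "\<dots> \<le> m X + (\<Sum>H\<in>P. g H) + (\<Sum>H\<in>P. 6 * card (f H))" using g by simp
    also have "\<dots> = m X + (\<Sum>H\<in>P. 6 * card (f H) + g H)" by (simp add: sum.distrib)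
    also have "\<dots> \<le> m X + (\<Sum>H\<in>P. m H + card (crossing H X))"
      using f(3) by (intro add_left_mono sum_mono)
    also have "\<dots> = m S" using m_delete[OF assms(5,4)] by simp
    finally show ?thesis .
  qed
  ultimately show ?thesis by (auto simp: slack_def)
qed

section \<open>The small graphs: 4-cycle, 5-cycle and diamond\<close>

lemma square_card: "square Q \<Longrightarrow> card Q = 4"
  using graph_iso_card_verts[of "induced Q" "cycle_graph 4"] by simp

lemma square_card_edges: "Q \<subseteq> V \<Longrightarrow> square Q \<Longrightarrow> m Q = 4"
  using graph_iso_card_edges[of "induced Q" "cycle_graph 4"] simple_induced
  by (simp add: simple_cycle_graph card_cycle_graph_edges)

lemma pentagon_card: "pentagon Q \<Longrightarrow> card Q = 5"
  using graph_iso_card_verts[of "induced Q" "cycle_graph 5"] by simp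

lemma pentagon_card_edges: "Q \<subseteq> V \<Longrightarrow> pentagon Q \<Longrightarrow> m Q = 5"
  using graph_iso_card_edges[of "induced Q" "cycle_graph 5"] simple_induced
  by (simp add: simple_cycle_graph card_cycle_graph_edges)

lemma diamond_card: "diamond Q \<Longrightarrow> card Q = 4"
  using graph_iso_card_verts[of "induced Q" diamond_graph] card_diamond_graph_verts by simp

lemma diamond_card_edges: "Q \<subseteq> V \<Longrightarrow> diamond Q \<Longrightarrow> m Q = 5"
  using graph_iso_card_edges[of "induced Q" diamond_graph] simple_induced
  by (simp add: simple_diamond_graph card_diamond_graph_edges)

lemma diamond_centre:
  assumes "diamond Q" obtains z where "z \<in> Q" "Q \<subseteq> N {z}"
proof -
  obtain g where g: "bij_betw g {1, 2, 3, 4} Q" and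
    e: "\<And>i j. i \<in> {1, 2, 3, 4} \<Longrightarrow> j \<in> {1, 2, 3, 4} \<Longrightarrow> {g i, g j} \<in> edges_in Q \<longleftrightarrow> {i, j} \<in> edges diamond_graph"
    using graph_iso_inverse[OF assms] by (auto simp: diamond_graph_def)
  have "Q = {g 1, g 2, g 3, g 4}" using g by (auto simp: bij_betw_def)
  moreover have "{g 1, g 2} \<in> E" "{g 1, g 3} \<in> E" "{g 1, g 4} \<in> E"
    using e[of 1 2] e[of 1 3] e[of 1 4] by (auto simp: diamond_graph_def edges_in_def doubleton_eq_iff)
  ultimately have "g 1 \<in> Q" "Q \<subseteq> N {g 1}" by (auto simp: N_iff)
  thus ?thesis using that by blast
qed

text \<open>The labels are rotated to start at \<open>h\<close>; \<open>b\<close> is the opposite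
  vertex, the only one whose adjacency to \<open>h\<close> is left open.\<close>

lemma square_vertex:
  assumes "square Q" "h \<in> Q"
  obtains a b c where "Q = {h, a, b, c}" "distinct [h, a, b, c]"
    "{h, a} \<in> E" "{h, c} \<in> E" "{b, a} \<in> E" "{b, c} \<in> E"
proof -
  obtain g where g: "bij_betw g {1..4} Q" and
    e: "\<And>i j. i \<in> {1..4} \<Longrightarrow> j \<in> {1..4} \<Longrightarrow> {g i, g j} \<in> edges_in Q \<longleftrightarrow> {i, j} \<in> edges (cycle_graph 4)"
    using graph_iso_inverse[OF assms(1)] by auto
  have s: "{1..4} = {1, 2, 3, 4::nat}" by auto
  have Q: "Q = {g 1, g 2, g 3, g 4}" using g unfolding s by (auto simp: bij_betw_def)
  have d: "distinct [g 1, g 2, g 3, g 4]" using g unfolding s by (auto simp: bij_betw_def inj_on_def)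
  have edges_in: "{g 1, g 2} \<in> E" "{g 2, g 3} \<in> E" "{g 3, g 4} \<in> E" "{g 4, g 1} \<in> E"
    using e[of 1 2] e[of 2 3] e[of 3 4] e[of 4 1] by (auto simp: cycle_graph_4 edges_in_def)
  have d2: "distinct [g 4, g 3, g 2, g 1]" using d by auto
  consider "h = g 1" | "h = g 2" | "h = g 3" | "h = g 4" using assms(2) Q by auto
  thus ?thesis
  proof cases
    case 1 show ?thesis by (rule that[of "g 2" "g 3" "g 4"]) (use 1 Q d edges_in in \<open>simp_all add: insert_commute\<close>)
  next
    case 2 show ?thesis by (rule that[of "g 3" "g 4" "g 1"]) (use 2 Q d d2 edges_in in \<open>simp_all add: insert_commute\<close>)
  next
    case 3 show ?thesis by (rule that[of "g 4" "g 1" "g 2"]) (use 3 Q d d2 edges_in in \<open>simp_all add: insert_commute\<close>)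
  next
    case 4 show ?thesis by (rule that[of "g 1" "g 2" "g 3"]) (use 4 Q d d2 edges_in in \<open>simp_all add: insert_commute\<close>)
  qed
qed

text \<open>The two non-edges leave \<open>a\<close> without neighbours in \<open>Q\<close> other
  than \<open>h\<close> and \<open>b\<close>, which is what the deletion of \<open>h\<close>
  exploits.\<close>

lemma pentagon_vertex:
  assumes "pentagon Q" "h \<in> Q"
  obtains a b c d where "Q = {h, a, b, c, d}" "distinct [h, a, b, c, d]"
    "{h, a} \<in> E" "{a, b} \<in> E" "{b, c} \<in> E" "{c, d} \<in> E" "{d, h} \<in> E" "{a, c} \<notin> E" "{a, d} \<notin> E"
proof -
  obtain g where g: "bij_betw g {1..5} Q" and
    e: "\<And>i j. i \<in> {1..5} \<Longrightarrow> j \<in> {1..5} \<Longrightarrow> {g i, g j} \<in> edges_in Q \<longleftrightarrow> {i, j} \<in> edges (cycle_graph 5)"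
    using graph_iso_inverse[OF assms(1)] by auto
  have s: "{1..5} = {1, 2, 3, 4, 5::nat}" by auto
  have Q: "Q = {g 1, g 2, g 3, g 4, g 5}" using g unfolding s by (auto simp: bij_betw_def)
  have d: "distinct [g 1, g 2, g 3, g 4, g 5]"
    using g unfolding s by (auto simp: bij_betw_def inj_on_def)
  have edges_in: "{g 1, g 2} \<in> E" "{g 2, g 3} \<in> E" "{g 3, g 4} \<in> E" "{g 4, g 5} \<in> E" "{g 5, g 1} \<in> E"
    using e[of 1 2] e[of 2 3] e[of 3 4] e[of 4 5] e[of 5 1] by (auto simp: cycle_graph_5 edges_in_def)
  have ne: "{g 1, g 3} \<notin> E" "{g 1, g 4} \<notin> E" "{g 2, g 4} \<notin> E" "{g 2, g 5} \<notin> E" "{g 3, g 5} \<notin> E"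
    using e[of 1 3] e[of 1 4] e[of 2 4] e[of 2 5] e[of 3 5] Q
    by (auto simp: cycle_graph_5 in_edges_in doubleton_eq_iff)
  have d2: "distinct [g 5, g 4, g 3, g 2, g 1]" using d by auto
  consider "h = g 1" | "h = g 2" | "h = g 3" | "h = g 4" | "h = g 5" using assms(2) Q by auto
  thus ?thesis
  proof cases
    case 1 show ?thesis by (rule that[of "g 2" "g 3" "g 4" "g 5"]) (use 1 Q d edges_in ne in \<open>simp_all add: insert_commute\<close>)
  next
    case 2 show ?thesis by (rule that[of "g 3" "g 4" "g 5" "g 1"]) (use 2 Q d d2 edges_in ne in \<open>simp_all add: insert_commute\<close>)
  next
    case 3 show ?thesis by (rule that[of "g 4" "g 5" "g 1" "g 2"]) (use 3 Q d d2 edges_in ne in \<open>simp_all add: insert_commute\<close>)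
  next
    case 4 show ?thesis by (rule that[of "g 5" "g 1" "g 2" "g 3"]) (use 4 Q d d2 edges_in ne in \<open>simp_all add: insert_commute\<close>)
  next
    case 5 show ?thesis by (rule that[of "g 1" "g 2" "g 3" "g 4"]) (use 5 Q d d2 edges_in ne in \<open>simp_all add: insert_commute\<close>)
  qed
qed

section \<open>Extremal graphs\<close>

text \<open>The pure special graphs of the statement, with the squares \<open>F\<close> and their attaching vertices \<open>w\<close>
  indexed by the tree vertices \<open>T\<close> instead of by numbers. The edge count follows from the other
  conditions; carrying it along avoids proving it.\<close>

definition pure_special :: "'a set \<Rightarrow> 'a set \<Rightarrow> ('a \<Rightarrow> 'a set) \<Rightarrow> ('a \<Rightarrow> 'a) \<Rightarrow> bool" where
  "pure_special S T F w \<longleftrightarrow> T \<noteq> {} \<and> S = T \<union> (\<Union>t\<in>T. F t) \<and>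
     (\<forall>t\<in>T. square (F t) \<and> F t \<inter> T = {} \<and> w t \<in> F t) \<and>
     (\<forall>s\<in>T. \<forall>t\<in>T. s \<noteq> t \<longrightarrow> F s \<inter> F t = {}) \<and>
     conn T \<and> (\<forall>C. cycle_set 3 C \<longrightarrow> \<not> C \<subseteq> T) \<and>
     edges_in S = edges_in T \<union> (\<Union>t\<in>T. insert {t, w t} (edges_in (F t))) \<and>
     m S + 1 = 6 * card T"

definition extremal :: "'a set \<Rightarrow> bool" where
  "extremal S \<longleftrightarrow> (\<exists>T F w. pure_special S T F w) \<or> diamond S \<or> pentagon S"

text \<open>The vertices at which two pure special graphs can be joined by a bridge without leaving
  the class. A vertex that is no hub lies outside the tree of every decomposition.\<close>

definition hub :: "'a set \<Rightarrow> 'a \<Rightarrow> bool" where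
  "hub S u \<longleftrightarrow> (\<exists>T F w. pure_special S T F w \<and> u \<in> T)"

lemma pure_specialD:
  assumes "pure_special S T F w"
  shows "T \<noteq> {}" "S = T \<union> (\<Union>t\<in>T. F t)" "conn T"
    "\<forall>t\<in>T. square (F t) \<and> F t \<inter> T = {} \<and> w t \<in> F t"
    "\<forall>s\<in>T. \<forall>t\<in>T. s \<noteq> t \<longrightarrow> F s \<inter> F t = {}"
    "\<forall>C. cycle_set 3 C \<longrightarrow> \<not> C \<subseteq> T"
    "edges_in S = edges_in T \<union> (\<Union>t\<in>T. insert {t, w t} (edges_in (F t)))"
    "m S + 1 = 6 * card T"
  by (rule assms[unfolded pure_special_def, elim_format], elim conjE, assumption)+

lemma pure_special_sq: "pure_special S T F w \<Longrightarrow> t \<in> T \<Longrightarrow> square (F t)"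
  and pure_special_w: "pure_special S T F w \<Longrightarrow> t \<in> T \<Longrightarrow> w t \<in> F t"
  and pure_special_T: "pure_special S T F w \<Longrightarrow> t \<in> T \<Longrightarrow> F t \<inter> T = {}"
  by (drule pure_specialD(4), simp)+

lemma pure_special_disj: "pure_special S T F w \<Longrightarrow> s \<in> T \<Longrightarrow> t \<in> T \<Longrightarrow> s \<noteq> t \<Longrightarrow> F s \<inter> F t = {}"
  by (drule pure_specialD(5)) simp

lemma pure_special_sub: "pure_special S T F w \<Longrightarrow> T \<subseteq> S" and pure_special_F_sub: "pure_special S T F w \<Longrightarrow> t \<in> T \<Longrightarrow> F t \<subseteq> S"
  by (drule pure_specialD(2), auto)+

lemma pure_special_cover:
  assumes "pure_special S T F w" "x \<in> S" "x \<notin> T" obtains t where "t \<in> T" "x \<in> F t"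
  using assms pure_specialD(2)[OF assms(1)] by auto

lemma pure_special_edge: "pure_special S T F w \<Longrightarrow> t \<in> T \<Longrightarrow> {t, w t} \<in> E"
proof -
  assume p: "pure_special S T F w" and t: "t \<in> T"
  have "{t, w t} \<in> edges_in T \<union> (\<Union>t\<in>T. insert {t, w t} (edges_in (F t)))" using t by auto
  hence "{t, w t} \<in> edges_in S" using pure_specialD(7)[OF p] by simp
  thus ?thesis by (simp add: edges_in_def)
qed

lemma pure_special_edge_cases:
  assumes "pure_special S T F w" "e \<in> edges_in S"
  obtains "e \<in> edges_in T" | t where "t \<in> T" "e = {t, w t}" | t where "t \<in> T" "e \<in> edges_in (F t)"
proof -
  have "e \<in> edges_in T \<union> (\<Union>t\<in>T. insert {t, w t} (edges_in (F t)))"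
    using assms(2) pure_specialD(7)[OF assms(1)] by simp
  thus ?thesis using that by auto
qed

text \<open>Tree edges and the edges of the other constituents do not touch \<open>F t\<close>, so
  the attaching edge is the only way out.\<close>

lemma pure_special_square_crossing:
  assumes p: "pure_special S T F w" and t: "t \<in> T"
  shows "crossing (F t) (S - F t) = {{t, w t}}"
proof
  have disj: "F s \<inter> F t = {}" if "s \<in> T" "s \<noteq> t" for s
    using pure_special_disj[OF p that(1) t that(2)] .
  have F: "F s \<inter> T = {}" "w s \<in> F s" if "s \<in> T" for s
    using pure_special_T[OF p that] pure_special_w[OF p that] .
  have sub: "F t \<subseteq> S" using pure_special_F_sub[OF p t] .
  show "crossing (F t) (S - F t) \<subseteq> {{t, w t}}"
  proof
    fix e assume "e \<in> crossing (F t) (S - F t)"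
    then obtain x y where e: "e = {x, y}" "x \<in> F t" "y \<in> S - F t" "{x, y} \<in> E" by (rule crossingE)
    hence "e \<in> edges_in S" using sub by (auto simp: in_edges_in)
    from p this show "e \<in> {{t, w t}}"
    proof (cases rule: pure_special_edge_cases)
      case 1
      thus ?thesis using F(1)[OF t] e by (auto simp: in_edges_in)
    next
      case (2 s)
      hence "x = w s \<or> x = s" using e by auto
      hence "s = t" using F[OF 2(1)] F(1)[OF t] e(2) 2(1) disj[OF 2(1)] by auto
      thus ?thesis using 2 by simp
    next
      case (3 s)
      hence "x \<in> F s" "y \<in> F s" using e by (auto simp: in_edges_in)
      thus ?thesis using e disj[OF 3(1)] by auto
    qed
  qed
  have "{w t, t} \<in> E" using pure_special_edge[OF p t] by (simp add: insert_commute)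
  moreover have "t \<in> S" "t \<notin> F t" using pure_special_sub[OF p] t F(1)[OF t] by auto
  ultimately have "{w t, t} \<in> crossing (F t) (S - F t)" using F(2)[OF t] by (intro crossingI) auto
  thus "{{t, w t}} \<subseteq> crossing (F t) (S - F t)" by (simp add: insert_commute)
qed

text \<open>A cycle cannot get across an attaching edge and back, and the tree vertices carry no
  cycle; so it lies within one square and, having at least four vertices, fills it.\<close>

lemma pure_special_cyc:
  assumes p: "pure_special S T F w" and C: "cycle_set 4 C" "C \<subseteq> S"
  obtains t where "t \<in> T" "C = F t"
proof -
  have C3: "cycle_set 3 C" using cycle_set_mono[OF C(1)] by simp
  have sep: "C \<subseteq> F t \<or> C \<inter> F t = {}" if "t \<in> T" for t
  proof (rule cycle_set_separated[OF C3])
    show "crossing (C \<inter> F t) (C - F t) \<subseteq> {{t, w t}}"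
      unfolding pure_special_square_crossing[OF p that, symmetric] using C(2) by (intro crossing_mono) auto
  qed auto
  have "\<not> C \<subseteq> T" using pure_specialD(6)[OF p] C3 by blast
  then obtain c where "c \<in> C" "c \<notin> T" by blast
  moreover from this obtain t where "t \<in> T" "c \<in> F t" using pure_special_cover[OF p, of c] C(2) by blast
  ultimately have c: "c \<in> C" "t \<in> T" "c \<in> F t" by simp_all
  hence "C \<subseteq> F t" using sep[of t] by auto
  moreover have c4: "card (F t) = 4" using pure_special_sq[OF p c(2)] square_card by simp
  moreover have "finite (F t)" using c4 by (intro card_ge_0_finite) simp
  ultimately have "C = F t" using cycle_set_card[OF C(1)] card_mono[of "F t" C]
    by (intro card_subset_eq) auto
  thus ?thesis using that c by blast
qed

section \<open>Extremal graphs with one vertex deleted or prescribed\<close>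

lemma no_long_cycle_if_small: "finite A \<Longrightarrow> card A < 4 \<Longrightarrow> C \<subseteq> A \<Longrightarrow> \<not> cycle_set 4 C"
  using cycle_set_subset_card[of 4 C A] by linarith

lemma pure_special_del:
  assumes S: "S \<subseteq> V" and p: "pure_special S T F w" and u: "u \<in> S" "u \<notin> T"
  shows "\<exists>D. isolates (S - {u}) D \<and> 6 * card D + 5 = m S"
proof -
  obtain t where t: "t \<in> T" "u \<in> F t" using pure_special_cover[OF p u] .
  have T: "T \<subseteq> S" using pure_special_sub[OF p] .
  have "finite T" using T S finite_sub by blast
  moreover have "isolates (S - {u}) (T - {t})"
    unfolding isolates_def
  proof (intro conjI allI impI)
    show "T - {t} \<subseteq> S - {u}" using T u by auto
    fix C assume C: "cycle_set 4 C" "C \<subseteq> S - {u}"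
    obtain s where s: "s \<in> T" "C = F s" using pure_special_cyc[OF p C(1)] C(2) by blast
    hence "s \<noteq> t" using t C(2) by auto
    moreover have "{s, w s} \<in> E" "w s \<in> F s" using pure_special_edge[OF p s(1)] pure_special_w[OF p s(1)] .
    ultimately have "w s \<in> C \<inter> N (T - {t})" using s by (auto simp: N_iff)
    thus "C \<inter> N (T - {t}) \<noteq> {}" by blast
  qed
  moreover have "m S + 1 = 6 * card T" using pure_specialD(8)[OF p] .
  moreover have "card T > 0" using t \<open>finite T\<close> by (auto simp: card_gt_0_iff)
  ultimately show ?thesis using t(1) by (intro exI[of _ "T - {t}"]) (auto simp: card_Diff_singleton)
qed

text \<open>The deletion leaves three vertices of a diamond, or a path on four vertices; so nothing
  has to be chosen.\<close>

lemma diamond_pentagon_del: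
  assumes S: "S \<subseteq> V" and e: "diamond S \<or> pentagon S" and u: "u \<in> S"
  shows "isolates (S - {u}) {} \<and> m S = 5"
proof (intro conjI)
  show "m S = 5" using e diamond_card_edges pentagon_card_edges S by blast
  show "isolates (S - {u}) {}"
    unfolding isolates_def
  proof (intro conjI allI impI)
    fix C assume C: "cycle_set 4 C" "C \<subseteq> S - {u}"
    have fS: "finite S" using S finite_sub by blast
    show "C \<inter> N {} \<noteq> {}"
    proof (cases "diamond S")
      case True
      hence "card (S - {u}) < 4" using u diamond_card by simp
      thus ?thesis using no_long_cycle_if_small[of "S - {u}" C] C fS by simp
    next
      case False
      hence ps: "pentagon S" using e by simp
      obtain a b c d where q: "S = {u, a, b, c, d}" "distinct [u, a, b, c, d]"
        "{a, c} \<notin> E" "{a, d} \<notin> E" by (rule pentagon_vertex[OF ps u])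
      have CS: "C \<subseteq> {a, b, c, d}" using C(2) q(1) by auto
      \<comment> \<open>Without \<open>a\<close> only three vertices remain; with \<open>a\<close>
        there is no cycle, since \<open>a\<close> keeps only the neighbour \<open>b\<close>.\<close>
      have "a \<in> C"
      proof (rule ccontr)
        assume "a \<notin> C"
        hence "C \<subseteq> {b, c, d}" using CS by auto
        moreover have "card {b, c, d} < 4" by (simp add: card_insert_if)
        ultimately show False using no_long_cycle_if_small[of "{b, c, d}" C] C(1) by simp
      qed
      then obtain y z where "y \<noteq> z" "y \<in> C" "z \<in> C" "{a, y} \<in> E" "{a, z} \<in> E"
        using cycle_set_degree[OF cycle_set_mono[OF C(1)], of a] by auto
      moreover have "x = b" if "x \<in> C" "{a, x} \<in> E" for x
        using that CS q(3,4) by auto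
      ultimately show ?thesis by blast
    qed
  qed simp
qed

lemma extremal_del:
  assumes "S \<subseteq> V" "extremal S" "u \<in> S" "\<not> hub S u"
  shows "\<exists>D. isolates (S - {u}) D \<and> 6 * card D + 5 = m S"
proof -
  consider T F w where "pure_special S T F w" | "diamond S \<or> pentagon S" using assms(2) unfolding extremal_def by blast
  thus ?thesis
  proof cases
    case 1
    hence "u \<notin> T" using assms(4) unfolding hub_def by blast
    thus ?thesis using pure_special_del[OF assms(1) 1 assms(3)] by simp
  next
    case 2
    thus ?thesis using diamond_pentagon_del[OF assms(1) 2 assms(3)] by (intro exI[of _ "{}"]) simp
  qed
qed

text \<open>For a hub, all tree vertices of its decomposition are chosen. Any other \<open>u\<close>
  is added to a set for \<open>S - {u}\<close>, at total cost \<open>(m S - 5) + 6\<close>.\<close>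

lemma extremal_through:
  assumes "S \<subseteq> V" "extremal S" "u \<in> S"
  shows "\<exists>D. isolates S D \<and> u \<in> D \<and> 6 * card D = m S + 1"
proof (cases "hub S u")
  case True
  then obtain T F w where p: "pure_special S T F w" "u \<in> T" unfolding hub_def by blast
  have "isolates S T"
    unfolding isolates_def
  proof (intro conjI allI impI)
    show "T \<subseteq> S" using pure_special_sub[OF p(1)] .
    fix C assume C: "cycle_set 4 C" "C \<subseteq> S"
    obtain s where s: "s \<in> T" "C = F s" using pure_special_cyc[OF p(1) C] by blast
    moreover have "{s, w s} \<in> E" "w s \<in> F s" using pure_special_edge[OF p(1) s(1)] pure_special_w[OF p(1) s(1)] .
    ultimately have "w s \<in> C \<inter> N T" by (auto simp: N_iff)
    thus "C \<inter> N T \<noteq> {}" by blast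
  qed
  moreover have "m S + 1 = 6 * card T" using pure_specialD(8)[OF p(1)] .
  ultimately show ?thesis using p(2) by auto
next
  case False
  then obtain D where D: "isolates (S - {u}) D" "6 * card D + 5 = m S" using extremal_del assms by blast
  have "isolates S (insert u D)"
    unfolding isolates_def
  proof (intro conjI allI impI)
    show "insert u D \<subseteq> S" using D(1) assms(3) unfolding isolates_def by blast
    fix C assume C: "cycle_set 4 C" "C \<subseteq> S"
    have "N D \<subseteq> N (insert u D)" by (rule N_mono) auto
    moreover have "u \<in> N (insert u D)" by (simp add: N_iff)
    moreover have "C \<inter> N D \<noteq> {}" if "u \<notin> C" using isolatesD[OF D(1) C(1)] that C(2) by blast
    ultimately show "C \<inter> N (insert u D) \<noteq> {}" by blast
  qed
  moreover have "D \<subseteq> S - {u}" using D(1) unfolding isolates_def by blast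
  moreover from this have "finite D" using assms(1) finite_sub finite_subset by blast
  ultimately have "card (insert u D) = Suc (card D)" using \<open>D \<subseteq> S - {u}\<close> by (intro card_insert_disjoint) auto
  thus ?thesis using \<open>isolates S (insert u D)\<close> D(2) by (intro exI[of _ "insert u D"]) simp
qed

lemma square_through:
  assumes "square S" "u \<in> S" shows "isolates S {u}"
  unfolding isolates_def
proof (intro conjI allI impI)
  fix C assume C: "cycle_set 4 C" "C \<subseteq> S"
  have "finite S" using square_card[OF assms(1)] by (intro card_ge_0_finite) simp
  hence "C = S" using cycle_set_card[OF C(1)] C(2) square_card[OF assms(1)] card_mono[of S C]
    by (intro card_subset_eq) auto
  thus "C \<inter> N {u} \<noteq> {}" using assms(2) by (auto simp: N_iff)
qed (use assms in auto)

text \<open>A nonempty part of \<open>A\<close> without the bridge end \<open>x\<close> has an edge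
  leaving it, and this edge stays inside \<open>A\<close>. A part containing \<open>x\<close> is
  handled through its complement in \<open>A\<close>.\<close>

lemma bridge_conn:
  assumes "conn (A \<union> B)" "A \<inter> B = {}" "A \<noteq> {}" "crossing A B \<subseteq> {{x, y}}" "x \<in> A" "y \<in> B"
  shows "conn A"
  unfolding conn_def
proof (intro conjI allI impI)
  fix Z assume Z: "Z \<subseteq> A" "Z \<noteq> {}" "Z \<noteq> A"
  have *: "\<exists>p\<in>Y. \<exists>q\<in>A - Y. {p, q} \<in> E" if Y: "Y \<subseteq> A" "Y \<noteq> {}" "x \<notin> Y" for Y
  proof -
    have "Y \<noteq> A \<union> B" using Y assms by auto
    then obtain p q where pq: "p \<in> Y" "q \<in> (A \<union> B) - Y" "{p, q} \<in> E"
      using conn_cut[OF assms(1), of Y] Y by blast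
    have "q \<in> A"
    proof (rule ccontr)
      assume "q \<notin> A"
      hence "{p, q} \<in> crossing A B" using pq Y(1) by (intro crossingI) auto
      hence "{p, q} = {x, y}" using assms(4) by blast
      thus False using pq(1) Y assms(2,6) by (auto simp: doubleton_eq_iff)
    qed
    thus ?thesis using pq by blast
  qed
  show "crossing Z (A - Z) \<noteq> {}"
  proof (cases "x \<in> Z")
    case False
    thus ?thesis using *[of Z] Z crossingI[of _ _ Z "A - Z"] by blast
  next
    case True
    then obtain p q where pq: "p \<in> A - Z" "q \<in> A - (A - Z)" "{p, q} \<in> E"
      using *[of "A - Z"] Z by blast
    hence "{p, q} \<in> crossing (A - Z) Z" by (intro crossingI) auto
    thus ?thesis using crossing_sym[of Z "A - Z"] by auto
  qed
qed fact

lemma bridge_cycle_side: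
  assumes "A \<inter> B = {}" "crossing A B \<subseteq> {{x, y}}" "cycle_set 3 C" "C \<subseteq> A \<union> B"
  shows "C \<subseteq> A \<or> C \<subseteq> B"
proof -
  have "crossing (C \<inter> A) (C - A) \<subseteq> {{x, y}}"
    using assms(2) crossing_mono[of "C \<inter> A" A "C - A" B] assms(4) by blast
  thus ?thesis using cycle_set_separated[OF assms(3), of "{{x, y}}" A] assms(4) by auto
qed

lemma bridge_isolates:
  assumes "A \<inter> B = {}" "crossing A B \<subseteq> {{x, y}}" "isolates A DA" "isolates B DB"
  shows "isolates (A \<union> B) (DA \<union> DB)"
  unfolding isolates_def
proof (intro conjI allI impI)
  show "DA \<union> DB \<subseteq> A \<union> B" using assms unfolding isolates_def by blast
  fix C assume C: "cycle_set 4 C" "C \<subseteq> A \<union> B"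
  thus "C \<inter> N (DA \<union> DB) \<noteq> {}"
    using bridge_cycle_side[OF assms(1,2) cycle_set_mono[OF C(1)] C(2)] isolatesD[OF assms(3) C(1)] isolatesD[OF assms(4) C(1)]
    unfolding N_Un by auto
qed

lemma conn_Un:
  assumes "conn A" "conn B" "A \<inter> B = {}" "{x, y} \<in> E" "x \<in> A" "y \<in> B"
  shows "conn (A \<union> B)"
  unfolding conn_def
proof (intro conjI allI impI)
  fix Z assume Z: "Z \<subseteq> A \<union> B" "Z \<noteq> {}" "Z \<noteq> A \<union> B"
  have half: "crossing Z ((A \<union> B) - Z) \<noteq> {}" if K: "conn K" "Z \<inter> K \<noteq> {}" "\<not> K \<subseteq> Z" "K \<subseteq> A \<union> B" for K
  proof -
    obtain p q where "p \<in> Z \<inter> K" "q \<in> K - (Z \<inter> K)" "{p, q} \<in> E"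
      using conn_cut[OF K(1), of "Z \<inter> K"] K by blast
    hence "{p, q} \<in> crossing Z ((A \<union> B) - Z)" using K(4) by (intro crossingI) auto
    thus ?thesis by blast
  qed
  consider "Z \<inter> A \<noteq> {}" "\<not> A \<subseteq> Z" | "Z \<inter> B \<noteq> {}" "\<not> B \<subseteq> Z" | "Z = A" | "Z = B" using Z by blast
  thus "crossing Z ((A \<union> B) - Z) \<noteq> {}"
  proof cases
    case 3
    hence "{x, y} \<in> crossing Z ((A \<union> B) - Z)" using assms by (intro crossingI) auto
    thus ?thesis by blast
  next
    case 4
    hence "{y, x} \<in> crossing Z ((A \<union> B) - Z)" using assms by (intro crossingI) (auto simp: insert_commute)
    thus ?thesis by blast
  qed (use half assms in auto)
qed (use assms in \<open>auto simp: conn_def\<close>)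

text \<open>The two trees, of sizes \<open>a\<close> and \<open>b\<close>, and the bridge form a
  tree again, and the edge numbers fit:
  \<open>(6 * a - 1) + (6 * b - 1) + 1 = 6 * (a + b) - 1\<close>.\<close>

lemma pure_special_merge:
  assumes SV: "A \<union> B \<subseteq> V" and AB: "A \<inter> B = {}" and e: "crossing A B = {{x, y}}"
    and A: "pure_special A TA FA wA" "x \<in> TA" and B: "pure_special B TB FB wB" "y \<in> TB"
  shows "\<exists>T F w. pure_special (A \<union> B) T F w"
proof -
  let ?F = "\<lambda>t. if t \<in> TA then FA t else FB t" and ?w = "\<lambda>t. if t \<in> TA then wA t else wB t"
  have TA: "TA \<subseteq> A" "\<And>t. t \<in> TA \<Longrightarrow> FA t \<subseteq> A" and TB: "TB \<subseteq> B" "\<And>t. t \<in> TB \<Longrightarrow> FB t \<subseteq> B"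
    using pure_special_sub[OF A(1)] pure_special_F_sub[OF A(1)] pure_special_sub[OF B(1)] pure_special_F_sub[OF B(1)] by simp_all
  have TAB: "TA \<inter> TB = {}" using TA(1) TB(1) AB by blast
  have nB: "t \<notin> TA" if "t \<in> TB" for t using that TAB by blast
  have F: "square (FA t)" "FA t \<inter> TA = {}" "wA t \<in> FA t" if "t \<in> TA" for t
    using pure_special_sq[OF A(1) that] pure_special_T[OF A(1) that] pure_special_w[OF A(1) that] .
  have F': "square (FB t)" "FB t \<inter> TB = {}" "wB t \<in> FB t" if "t \<in> TB" for t
    using pure_special_sq[OF B(1) that] pure_special_T[OF B(1) that] pure_special_w[OF B(1) that] .
  have d: "FA s \<inter> FA t = {}" if "s \<in> TA" "t \<in> TA" "s \<noteq> t" for s t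
    using pure_special_disj[OF A(1) that] .
  have d': "FB s \<inter> FB t = {}" if "s \<in> TB" "t \<in> TB" "s \<noteq> t" for s t
    using pure_special_disj[OF B(1) that] .
  have xyE: "{x, y} \<in> E" using e by (auto simp: crossing_def)
  have bT: "crossing TA TB = {{x, y}}"
  proof
    show "crossing TA TB \<subseteq> {{x, y}}" using crossing_mono[OF TA(1) TB(1)] e by simp
    show "{{x, y}} \<subseteq> crossing TA TB" using crossingI[OF xyE A(2) B(2)] by simp
  qed
  have "pure_special (A \<union> B) (TA \<union> TB) ?F ?w"
    unfolding pure_special_def
  proof (intro conjI ballI allI impI)
    show "TA \<union> TB \<noteq> {}" using A(2) by auto
    have "A = TA \<union> (\<Union>t\<in>TA. FA t)" "B = TB \<union> (\<Union>t\<in>TB. FB t)"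
      using pure_specialD(2)[OF A(1)] pure_specialD(2)[OF B(1)] .
    moreover have "(\<Union>t\<in>TA \<union> TB. ?F t) = (\<Union>t\<in>TA. FA t) \<union> (\<Union>t\<in>TB. FB t)"
      using nB by (auto split: if_splits)
    ultimately show "A \<union> B = TA \<union> TB \<union> (\<Union>t\<in>TA \<union> TB. ?F t)" by auto
    show "conn (TA \<union> TB)"
      using conn_Un[OF pure_specialD(3)[OF A(1)] pure_specialD(3)[OF B(1)] TAB xyE A(2) B(2)] .
    show "square (?F t)" if "t \<in> TA \<union> TB" for t using that F(1) F'(1) by auto
    show "?w t \<in> ?F t" if "t \<in> TA \<union> TB" for t using that F(3) F'(3) by auto
    show "?F t \<inter> (TA \<union> TB) = {}" if "t \<in> TA \<union> TB" for t
    proof (cases "t \<in> TA")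
      case True
      hence "FA t \<inter> TB = {}" using TA(2)[OF True] TB(1) AB by blast
      thus ?thesis using F(2)[OF True] True by auto
    next
      case False
      hence t: "t \<in> TB" using that by simp
      hence "FB t \<inter> TA = {}" using TB(2)[OF t] TA(1) AB by blast
      thus ?thesis using F'(2)[OF t] False by auto
    qed
    show "?F s \<inter> ?F t = {}" if st: "s \<in> TA \<union> TB" "t \<in> TA \<union> TB" "s \<noteq> t" for s t
    proof -
      have AB': "FA p \<inter> FB q = {}" if "p \<in> TA" "q \<in> TB" for p q
        using TA(2)[OF that(1)] TB(2)[OF that(2)] AB by blast
      consider "s \<in> TA" "t \<in> TA" | "s \<in> TA" "t \<in> TB" | "s \<in> TB" "t \<in> TA" | "s \<in> TB" "t \<in> TB"
        using st by blast
      thus ?thesis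
      proof cases
        case 1 thus ?thesis using d[of s t] st(3) by simp
      next
        case 2 thus ?thesis using AB'[of s t] nB by simp
      next
        case 3 thus ?thesis using AB'[of t s] nB by (simp add: Int_commute)
      next
        case 4 thus ?thesis using d'[of s t] st(3) nB by simp
      qed
    qed
    show "\<not> C \<subseteq> TA \<union> TB" if "cycle_set 3 C" for C
      using bridge_cycle_side[OF TAB, of x y C] bT that pure_specialD(6)[OF A(1)] pure_specialD(6)[OF B(1)] by auto
    have "edges_in A = edges_in TA \<union> (\<Union>t\<in>TA. insert {t, wA t} (edges_in (FA t)))"
      "edges_in B = edges_in TB \<union> (\<Union>t\<in>TB. insert {t, wB t} (edges_in (FB t)))"
      using pure_specialD(7)[OF A(1)] pure_specialD(7)[OF B(1)] .
    moreover have "(\<Union>t\<in>TA \<union> TB. insert {t, ?w t} (edges_in (?F t))) =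
        (\<Union>t\<in>TA. insert {t, wA t} (edges_in (FA t))) \<union> (\<Union>t\<in>TB. insert {t, wB t} (edges_in (FB t)))"
      using nB by (auto split: if_splits)
    ultimately show "edges_in (A \<union> B) = edges_in (TA \<union> TB) \<union> (\<Union>t\<in>TA \<union> TB. insert {t, ?w t} (edges_in (?F t)))"
      unfolding edges_in_Un[OF AB] edges_in_Un[OF TAB] bT e by auto
    have "finite TA" "finite TB" using TA(1) TB(1) SV finite_sub by auto
    hence "card (TA \<union> TB) = card TA + card TB" using TAB by (rule card_Un_disjoint)
    moreover have "m A + 1 = 6 * card TA" "m B + 1 = 6 * card TB"
      using pure_specialD(8)[OF A(1)] pure_specialD(8)[OF B(1)] .
    moreover have "m (A \<union> B) = m A + m B + 1" using card_edges_in_Un[OF AB] e by simp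
    ultimately show "m (A \<union> B) + 1 = 6 * card (TA \<union> TB)" by simp
  qed
  thus ?thesis by blast
qed

section \<open>Bridges\<close>

text \<open>The induction hypothesis as a predicate, so that the cases of the induction can be
  separate lemmas.\<close>

definition smaller_ok :: "'a set \<Rightarrow> bool" where
  "smaller_ok S \<longleftrightarrow> (\<forall>R. R \<subset> S \<longrightarrow> conn R \<longrightarrow> square R \<or> slack R \<or> extremal R)"

lemma smaller_okD: "smaller_ok S \<Longrightarrow> R \<subset> S \<Longrightarrow> conn R \<Longrightarrow> square R \<or> slack R \<or> extremal R"
  by (simp add: smaller_ok_def)

lemma extremal_nonempty: "extremal S \<Longrightarrow> S \<noteq> {}"
  unfolding extremal_def using diamond_card[of S] pentagon_card[of S] pure_specialD(1) pure_special_sub by fastforce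

lemma extremal_isolates:
  assumes "S \<subseteq> V" "extremal S" shows "\<exists>D. isolates S D \<and> 6 * card D = m S + 1"
  using extremal_through[OF assms] extremal_nonempty[OF assms(2)] by blast

lemma slack_extremal_isolates:
  assumes "S \<subseteq> V" "slack S \<or> extremal S" shows "\<exists>D. isolates S D \<and> 6 * card D \<le> m S + 1"
  using assms(2)
proof
  assume "slack S" thus ?thesis unfolding slack_def by (metis le_SucI Suc_eq_plus1)
next
  assume "extremal S" thus ?thesis using extremal_isolates[OF assms(1)] by (metis order_refl)
qed

text \<open>The edge of the bridge pays for one extremal side. Two extremal sides overspend by one,
  so a vertex has to be saved unless both bridge ends are hubs.\<close>

lemma bridge_not_square:
  assumes S: "S \<subseteq> V" "conn S" "smaller_ok S"
    and AB: "A \<union> B = S" "A \<inter> B = {}" "card (crossing A B) = 1" "\<not> square A" "\<not> square B"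
  shows "slack S \<or> extremal S"
proof -
  obtain e where e: "crossing A B = {e}" using AB(3) by (meson card_1_singletonE)
  then obtain x y where xy: "e = {x, y}" "x \<in> A" "y \<in> B" "{x, y} \<in> E"
    using crossingE[of e A B] by blast
  have b: "crossing A B = {{x, y}}" and b': "crossing B A = {{y, x}}"
    using e xy(1) crossing_sym[of B A] by (simp_all add: insert_commute)
  have V: "A \<subseteq> V" "B \<subseteq> V" using AB(1) S(1) by auto
  have "conn A" using bridge_conn[of A B x y] AB S(2) xy b by auto
  moreover have "conn B" using bridge_conn[of B A y x] AB S(2) xy b' by (auto simp: Un_commute)
  moreover have "A \<subset> S" "B \<subset> S" using AB xy by auto
  ultimately have IH: "slack A \<or> extremal A" "slack B \<or> extremal B" using smaller_okD[OF S(3)] AB(4,5) by blast+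
  have mS: "m S = m A + m B + 1" using card_edges_in_Un[OF AB(2)] b AB(1) by simp
  have un: "isolates S (DA \<union> DB)" if "isolates A DA" "isolates B DB" for DA DB
    using bridge_isolates[OF AB(2), of x y DA DB] b that AB(1) by simp
  have cardU: "6 * card (DA \<union> DB) \<le> 6 * card DA + 6 * card DB" for DA DB :: "'a set"
    using card_Un_le[of DA DB] by simp
  have half: "slack S" if PQ: "slack P" "slack Q \<or> extremal Q" "P = A \<and> Q = B \<or> P = B \<and> Q = A" for P Q
  proof -
    obtain D where D: "isolates P D" "6 * card D \<le> m P" using PQ(1) unfolding slack_def by blast
    have "Q \<subseteq> V" using V PQ(3) by auto
    then obtain D' where D': "isolates Q D'" "6 * card D' \<le> m Q + 1"
      using slack_extremal_isolates[OF _ PQ(2)] by blast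
    have "isolates S (D \<union> D')"
      using PQ(3) un[of D D'] un[of D' D] D(1) D'(1) by (auto simp: Un_commute)
    moreover have "6 * card (D \<union> D') \<le> m S" using cardU[of D D'] D D' mS PQ(3) by auto
    ultimately show ?thesis unfolding slack_def by blast
  qed
  \<comment> \<open>A set for \<open>Q\<close> through \<open>q\<close> dominates \<open>p\<close>
    at no extra cost; then only \<open>P - {p}\<close> is left to isolate, six units cheaper than
    \<open>P\<close>.\<close>
  have sv: "slack S" if nh: "\<not> hub P p" and pq: "P = A \<and> Q = B \<or> P = B \<and> Q = A"
    "{q, p} \<in> E" "p \<in> P" "q \<in> Q" and ex: "extremal P" "extremal Q" for P Q p q
  proof -
    have PV: "P \<subseteq> V" "Q \<subseteq> V" using pq(1) V by auto
    obtain D where D: "isolates (P - {p}) D" "6 * card D + 5 = m P"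
      using extremal_del[OF PV(1) ex(1) pq(3) nh] by blast
    obtain D' where D': "isolates Q D'" "q \<in> D'" "6 * card D' = m Q + 1"
      using extremal_through[OF PV(2) ex(2) pq(4)] by blast
    have "isolates S (D \<union> D')"
      unfolding isolates_def
    proof (intro conjI allI impI)
      show "D \<union> D' \<subseteq> S" using D(1) D'(1) pq(1) AB(1) unfolding isolates_def by auto
      fix C assume C: "cycle_set 4 C" "C \<subseteq> S"
      have "C \<subseteq> A \<or> C \<subseteq> B"
        using bridge_cycle_side[OF AB(2), of x y C] b cycle_set_mono[OF C(1), of 3] C(2) AB(1) by simp
      then consider "C \<subseteq> Q" | "C \<subseteq> P - {p}" | "p \<in> C" using pq(1) by blast
      thus "C \<inter> N (D \<union> D') \<noteq> {}"
      proof cases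
        case 1 thus ?thesis using isolatesD[OF D'(1) C(1)] unfolding N_Un by auto
      next
        case 2 thus ?thesis using isolatesD[OF D(1) C(1)] unfolding N_Un by auto
      next
        case 3
        moreover have "p \<in> N D'" using pq(2) D'(2) by (auto simp: N_iff)
        ultimately show ?thesis unfolding N_Un by blast
      qed
    qed
    moreover have "6 * card (D \<union> D') \<le> m S" using cardU[of D D'] D(2) D'(3) mS pq(1) by auto
    ultimately show ?thesis unfolding slack_def by blast
  qed
  consider "slack A" | "slack B" | "extremal A" "extremal B" using IH by blast
  thus ?thesis
  proof cases
    case 1 thus ?thesis using half[of A B] IH(2) by simp
  next
    case 2 thus ?thesis using half[of B A] IH(1) by simp
  next
    case 3
    have yx: "{y, x} \<in> E" using xy(4) by (simp add: insert_commute)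
    show ?thesis
    proof (cases "hub A x \<and> hub B y")
      case True
      then obtain TA FA wA TB FB wB where "pure_special A TA FA wA" "x \<in> TA" "pure_special B TB FB wB" "y \<in> TB"
        unfolding hub_def by blast
      hence "\<exists>T F w. pure_special S T F w" using pure_special_merge[of A B x y] AB(1,2) b S(1) by simp
      thus ?thesis unfolding extremal_def by blast
    next
      case False
      thus ?thesis using sv[of A x B y] sv[of B y A x] 3 xy yx by blast
    qed
  qed
qed

lemma conn_singleton: "conn {y}" unfolding conn_def by auto

text \<open>With \<open>y\<close> chosen and only \<open>y\<close> deleted, the square and its link
  yield five of the six units needed; the other components decide whether a sixth is found.\<close>

lemma bridge_square:
  assumes S: "S \<subseteq> V" "conn S" "smaller_ok S"
    and AB: "A \<union> B = S" "A \<inter> B = {}" "card (crossing A B) = 1" "square A"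
  shows "slack S \<or> extremal S"
proof -
  obtain e where e: "crossing A B = {e}" using AB(3) by (meson card_1_singletonE)
  then obtain x y where xy: "e = {x, y}" "x \<in> A" "y \<in> B" "{x, y} \<in> E"
    using crossingE[of e A B] by blast
  have b: "crossing A B = {{x, y}}" using e xy(1) by simp
  have V: "A \<subseteq> V" "B \<subseteq> V" using AB(1) S(1) by auto
  have fS: "finite S" using S(1) finite_sub by blast
  have "finite (B - {y})" using AB(1) fS by auto
  then obtain P' where P': "components (B - {y}) P'" using components_exist by blast
  have "conn A" using bridge_conn[of A B x y] AB S(2) xy b by auto
  hence PA: "components A {A}" by (auto simp: components_def)
  have noA: "{a, z} \<notin> E" if "a \<in> A" "z \<in> B - {y}" for a z
  proof
    assume "{a, z} \<in> E"
    hence "{a, z} \<in> crossing A B" using that by (intro crossingI) auto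
    thus False using b that xy(2,3) AB(2) by (auto simp: doubleton_eq_iff)
  qed
  have "f \<notin> crossing A (B - {y})" for f using noA by (auto elim!: crossingE)
  hence "components (A \<union> (B - {y})) ({A} \<union> P')" using AB(2) by (intro components_Un[OF PA P']) auto
  moreover have "A \<union> (B - {y}) = S - {y}" using AB(1,2) xy(3) by auto
  ultimately have P: "components (S - {y}) (insert A P')" by simp
  have HB: "H \<subseteq> B - {y}" if "H \<in> P'" for H using component_subset[OF P' that] .
  have AP: "A \<notin> P'" using HB[of A] xy(2) AB(2) by auto
  have fP: "finite P'" using P' by (simp add: components_def)
  \<comment> \<open>A square is isolated by \<open>y\<close> alone, so all its edges and links are
    gain, for \<open>A\<close> itself 4 + 1. Any other component may overspend by one; the
    subtraction does not truncate, since each component has a link.\<close>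
  define g where "g H = (if H = A then 5 else if square H then m H + card (crossing H {y}) else card (crossing H {y}) - 1)" for H
  have yS: "y \<in> S" using xy(3) AB(1) by auto
  have bdH: "crossing H (S - H) = crossing H {y}" if "H \<in> insert A P'" for H
  proof -
    have "{y} \<union> (S - {y}) = S" using yS by auto
    thus ?thesis using component_crossing[OF P that, of "{y}"] by simp
  qed
  have dH: "crossing H {y} \<noteq> {}" if "H \<in> insert A P'" for H
  proof -
    have "H \<subseteq> S - {y}" using component_subset[OF P that] .
    moreover have "H \<noteq> {}" using component_nonempty[OF P that] .
    ultimately have "crossing H (S - H) \<noteq> {}" using S(2) yS unfolding conn_def by blast
    thus ?thesis using bdH[OF that] by simp
  qed
  have sqfree: "C \<inter> N {y} \<noteq> {}" if HC: "square H" "cycle_set 4 C" "C \<subseteq> H" "H \<in> insert A P'" for H C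
  proof -
    have c4: "card H = 4" using square_card[OF HC(1)] .
    hence "finite H" by (intro card_ge_0_finite) simp
    hence "C = H" using cycle_set_card[OF HC(2)] HC(3) card_mono[of H C] c4 by (intro card_subset_eq) auto
    moreover obtain f where "f \<in> crossing H {y}" using dH[OF HC(4)] by blast
    then obtain z where "z \<in> H" "{z, y} \<in> E" using crossingE[of f H "{y}"] by blast
    ultimately show ?thesis by (auto simp: N_iff insert_commute)
  qed
  have mA: "m A = 4" using square_card_edges V AB(4) by blast
  have bAy: "card (crossing A {y}) = 1"
  proof -
    have "crossing A {y} = {{x, y}}" using crossingI[OF xy(4) xy(2), of "{y}"] crossing_mono[of A A "{y}" B] b xy(3) by auto
    thus ?thesis by simp
  qed
  have cost: "\<exists>D\<subseteq>H. (\<forall>C. cycle_set 4 C \<longrightarrow> C \<subseteq> H \<longrightarrow> C \<inter> (N D \<union> N {y}) \<noteq> {}) \<and>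
        6 * card D + g H \<le> m H + card (crossing H {y})" if H: "H \<in> insert A P'" for H
  proof (cases "square H")
    case True
    have "g H \<le> m H + card (crossing H {y})" using True mA bAy by (simp add: g_def)
    thus ?thesis using sqfree[OF True _ _ H] by (intro exI[of _ "{}"]) auto
  next
    case False
    have HA: "H \<noteq> A" using False AB(4) by auto
    have "conn H" using P H unfolding components_def by blast
    moreover have "H \<subset> S" using component_subset[OF P H] yS by auto
    ultimately have "slack H \<or> extremal H" using smaller_okD[OF S(3)] False by blast
    moreover have "H \<subseteq> V" using \<open>H \<subset> S\<close> S(1) by auto
    ultimately obtain D where D: "isolates H D" "6 * card D \<le> m H + 1"
      using slack_extremal_isolates[of H] by blast
    have "card (crossing H {y}) \<noteq> 0" using dH[OF H] by simp
    moreover have "g H = card (crossing H {y}) - 1" using HA False by (simp add: g_def)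
    ultimately have "6 * card D + g H \<le> m H + card (crossing H {y})" using D(2) by linarith
    moreover have "D \<subseteq> H" using D(1) unfolding isolates_def by blast
    moreover have "C \<inter> (N D \<union> N {y}) \<noteq> {}" if "cycle_set 4 C" "C \<subseteq> H" for C
      using isolatesD[OF D(1) that] by blast
    ultimately show ?thesis by blast
  qed
  have sumg: "(\<Sum>H\<in>insert A P'. g H) = 5 + (\<Sum>H\<in>P'. g H)" using AP fP by (simp add: g_def)
  show ?thesis
  proof (cases "(\<Sum>H\<in>P'. g H) = 0")
    case False
    have "slack S"
    proof (rule slack_by_gain[OF S(1) yS _ _ P cost])
      show "6 \<le> m {y} + (\<Sum>H\<in>insert A P'. g H)" using sumg False by simp
      show "{y} \<subseteq> N {y}" "{y} \<subseteq> S" using yS by (simp_all add: N_iff)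
    qed
    thus ?thesis ..
  next
    case True
    \<comment> \<open>Zero gain forces every further component to be a non-square attached to
      \<open>y\<close> by a bridge.\<close>
    hence g0: "g H = 0" if "H \<in> P'" for H using that fP by simp
    show ?thesis
    proof (cases "P' = {}")
      case True
      hence "B - {y} = {}" using P' by (simp add: components_def)
      hence B: "B = {y}" using xy(3) by auto
      have mS: "m S = 5" using card_edges_in_Un[OF AB(2)] AB(1) B b mA by simp
      \<comment> \<open>A square with a pendant vertex: the pure special graph with a single tree
        vertex.\<close>
      have "pure_special S {y} (\<lambda>_. A) (\<lambda>_. x)"
        unfolding pure_special_def
      proof (intro conjI)
        show "edges_in S = edges_in {y} \<union> (\<Union>t\<in>{y}. insert {t, x} (edges_in A))"
          using edges_in_Un[OF AB(2)] AB(1) B b by (auto simp: insert_commute)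
        show "\<forall>C. cycle_set 3 C \<longrightarrow> \<not> C \<subseteq> {y}" using cycle_set_subset_card[of 3 _ "{y}"] by auto
      qed (use AB B xy mS conn_singleton in auto)
      thus ?thesis unfolding extremal_def by blast
    next
      case False
      then obtain H where H: "H \<in> P'" by blast
      have HA: "H \<noteq> A" using H AP by auto
      have HV: "H \<subseteq> V" using HB[OF H] V by auto
      have nsq: "\<not> square H" using g0[OF H] HA square_card_edges[OF HV] by (auto simp: g_def)
      have "card (crossing H {y}) = 1"
      proof -
        have "card (crossing H {y}) \<noteq> 0" using dH[of H] H by simp
        moreover have "g H = card (crossing H {y}) - 1" using HA nsq by (simp add: g_def)
        ultimately show ?thesis using g0[OF H] by linarith
      qed
      hence c1: "card (crossing H (S - H)) = 1" using bdH[of H] H by simp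
      \<comment> \<open>The far side of this bridge has at least five vertices and is no square
        either, so the case of two non-squares applies.\<close>
      have "A \<union> {y} \<subseteq> S - H" using HB[OF H] AB yS by auto
      hence "card (A \<union> {y}) \<le> card (S - H)" using fS by (intro card_mono) auto
      moreover have "card (A \<union> {y}) = 5"
        using square_card[OF AB(4)] xy(3) AB(2) V finite_sub by (subst card_Un_disjoint) auto
      ultimately have "\<not> square (S - H)" using square_card[of "S - H"] by auto
      moreover have "H \<union> (S - H) = S" using HB[OF H] AB(1) by auto
      ultimately show ?thesis using bridge_not_square[OF S, of H "S - H"] c1 nsq by blast
    qed
  qed
qed

section \<open>Bridgeless graphs\<close>

text \<open>A condition on all vertex cuts rather than on single edges: it contains connectedness of
  a nonempty \<open>S\<close>, and a cut around one vertex shows that its degree is at least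
  two.\<close>

definition bridgeless :: "'a set \<Rightarrow> bool" where
  "bridgeless S \<longleftrightarrow> (\<forall>A. A \<subseteq> S \<longrightarrow> A \<noteq> {} \<longrightarrow> A \<noteq> S \<longrightarrow> 2 \<le> card (crossing A (S - A)))"

lemma bridge_case:
  assumes S: "S \<subseteq> V" "conn S" "smaller_ok S" and "\<not> bridgeless S"
  shows "slack S \<or> extremal S"
proof -
  obtain A where A: "A \<subseteq> S" "A \<noteq> {}" "A \<noteq> S" "\<not> 2 \<le> card (crossing A (S - A))"
    using assms(4) unfolding bridgeless_def by blast
  have "crossing A (S - A) \<noteq> {}" using S(2) A(1-3) unfolding conn_def by blast
  hence "card (crossing A (S - A)) \<noteq> 0" by simp
  hence c1: "card (crossing A (S - A)) = 1" using A(4) by linarith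
  hence c: "card (crossing A (S - A)) = 1" "card (crossing (S - A) A) = 1" unfolding crossing_sym[of "S - A" A] by simp_all
  have u: "A \<union> (S - A) = S" "(S - A) \<union> A = S" using A(1) by auto
  show ?thesis
    using bridge_not_square[OF S u(1)] bridge_square[OF S u(1)] bridge_square[OF S u(2)] c by blast
qed

text \<open>The four edges of \<open>Q\<close> and its two links amount to six, exactly the price of
  one more vertex. On the side of \<open>Q\<close> it is enough to dominate the end \<open>h\<close>
  of one link: three vertices of \<open>Q\<close> remain, and only the other link can still be
  used.\<close>

lemma square_two_edges:
  assumes S: "S \<subseteq> V" "smaller_ok S" "bridgeless S"
    and Q: "square Q" "Q \<subseteq> S" "card (crossing Q (S - Q)) = 2"
  shows "slack S"
proof -
  obtain e where e0: "e \<in> crossing Q (S - Q)" using Q(3) by (metis card.empty ex_in_conv zero_neq_numeral)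
  then obtain h x where e: "e = {h, x}" "h \<in> Q" "x \<in> S - Q" "{h, x} \<in> E" by (rule crossingE)
  have fQ: "finite Q" "card Q = 4" using Q(2) S(1) finite_sub square_card[OF Q(1)] by auto
  have conn: "conn (S - Q)"
    unfolding conn_def
  proof (intro conjI allI impI)
    show "S - Q \<noteq> {}" using e(3) by auto
    fix Z assume Z: "Z \<subseteq> S - Q" "Z \<noteq> {}" "Z \<noteq> S - Q"
    show "crossing Z (S - Q - Z) \<noteq> {}"
    proof
      assume b0: "crossing Z (S - Q - Z) = {}"
      define Z' where "Z' = S - Q - Z"
      \<comment> \<open>A part of \<open>S - Q\<close> without edges to the rest of
        \<open>S - Q\<close> has at least two links to \<open>Q\<close>; two such parts would need
        four.\<close>
      have le: "2 \<le> card (crossing Y Q)" if "Y \<subseteq> S - Q" "Y \<noteq> {}" "crossing Y (S - Q - Y) = {}" for Y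
      proof -
        have "2 \<le> card (crossing Y (S - Y))"
          using S(3) that(1,2) e(2) Q(2) unfolding bridgeless_def by blast
        also have "crossing Y (S - Y) \<subseteq> crossing Y Q"
        proof
          fix f assume "f \<in> crossing Y (S - Y)"
          then obtain p q where f: "f = {p, q}" "p \<in> Y" "q \<in> S - Y" "{p, q} \<in> E" by (rule crossingE)
          have "q \<in> Q" using crossingI[of p q Y "S - Q - Y"] f that(3) by blast
          thus "f \<in> crossing Y Q" using f by (simp add: crossingI)
        qed
        hence "card (crossing Y (S - Y)) \<le> card (crossing Y Q)" by (intro card_mono) auto
        finally show ?thesis .
      qed
      have ZZ: "S - Q - Z' = Z" using Z(1) by (auto simp: Z'_def)
      have "crossing Z' (S - Q - Z') = {}" using b0 unfolding ZZ by (simp add: Z'_def crossing_sym)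
      hence "2 \<le> card (crossing Z Q)" "2 \<le> card (crossing Z' Q)" using le[of Z] le[of Z'] Z b0 by (auto simp: Z'_def)
      moreover have "crossing Z Q \<inter> crossing Z' Q = {}" using Z(1) by (auto simp: crossing_def Z'_def doubleton_eq_iff)
      hence "card (crossing Z Q \<union> crossing Z' Q) = card (crossing Z Q) + card (crossing Z' Q)" by (simp add: card_Un_disjoint)
      moreover have "crossing Z Q \<union> crossing Z' Q \<subseteq> crossing Q (S - Q)"
        using crossing_mono[of Z "S - Q" Q Q] crossing_mono[of Z' "S - Q" Q Q] Z(1) crossing_sym[of Q "S - Q"]
        by (auto simp: Z'_def)
      hence "card (crossing Z Q \<union> crossing Z' Q) \<le> 2" unfolding Q(3)[symmetric] by (intro card_mono) auto
      ultimately show False by linarith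
    qed
  qed
  have key: "isolates S D" if D: "D \<subseteq> S" "h \<in> N D" "\<And>C. cycle_set 4 C \<Longrightarrow> C \<subseteq> S - Q \<Longrightarrow> C \<inter> N D \<noteq> {}" for D
    unfolding isolates_def
  proof (intro conjI allI impI)
    show "D \<subseteq> S" by fact
    fix C assume C: "cycle_set 4 C" "C \<subseteq> S"
    show "C \<inter> N D \<noteq> {}"
    proof
      assume C0: "C \<inter> N D = {}"
      hence hC: "h \<notin> C" using D(2) by blast
      have "C \<subseteq> Q \<or> C \<inter> Q = {}"
      proof (rule cycle_set_separated[OF cycle_set_mono[OF C(1)]])
        show "card (crossing Q (S - Q) - {e}) \<le> 1" using Q(3) e0 by simp
        have "crossing (C \<inter> Q) (C - Q) \<subseteq> crossing Q (S - Q)" using C(2) by (intro crossing_mono) auto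
        moreover have "e \<notin> crossing (C \<inter> Q) (C - Q)" using hC e(1) by (auto simp: crossing_def doubleton_eq_iff)
        ultimately show "crossing (C \<inter> Q) (C - Q) \<subseteq> crossing Q (S - Q) - {e}" by blast
      qed auto
      thus False
      proof
        assume "C \<subseteq> Q"
        hence "C \<subseteq> Q - {h}" using hC by auto
        thus False using no_long_cycle_if_small[of "Q - {h}" C] fQ e(2) C(1) by simp
      next
        assume "C \<inter> Q = {}"
        thus False using D(3)[OF C(1)] C(2) C0 by blast
      qed
    qed
  qed
  have mQ: "m Q = 4" using square_card_edges[OF _ Q(1)] Q(2) S(1) by auto
  have "m (Q \<union> (S - Q)) = m Q + m (S - Q) + 2" using card_edges_in_Un[of Q "S - Q"] Q(3) by simp
  moreover have "Q \<union> (S - Q) = S" using Q(2) by auto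
  ultimately have mS: "m S = m (S - Q) + 6" using mQ by simp
  have SV: "S - Q \<subseteq> V" using S(1) by auto
  have hx: "h \<in> N D" if "x \<in> D" for D using e(4) that by (auto simp: N_iff insert_commute)
  have "S - Q \<subset> S" using e(2) Q(2) by auto
  then consider "square (S - Q)" | "slack (S - Q)" | "extremal (S - Q)" using smaller_okD[OF S(2) _ conn] by blast
  thus ?thesis
  proof cases
    case 1
    have "isolates S {x}" by (rule key) (use e(3) hx isolatesD[OF square_through[OF 1 e(3)]] in auto)
    thus ?thesis using mS square_card_edges[OF SV 1] unfolding slack_def by (intro exI[of _ "{x}"]) simp
  next
    case 2
    then obtain D where D: "isolates (S - Q) D" "6 * card D \<le> m (S - Q)" unfolding slack_def by blast
    have N: "N D \<subseteq> N (insert h D)" "h \<in> N (insert h D)" by (auto simp: N_iff)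
    have "isolates S (insert h D)"
    proof (rule key)
      show "insert h D \<subseteq> S" using D(1) e(2) Q(2) unfolding isolates_def by blast
      fix C assume "cycle_set 4 C" "C \<subseteq> S - Q"
      thus "C \<inter> N (insert h D) \<noteq> {}" using isolatesD[OF D(1)] N(1) by blast
    qed (rule N(2))
    moreover have "card (insert h D) \<le> Suc (card D)" by (cases "finite D") (auto simp: card_insert_if)
    hence "6 * card (insert h D) \<le> m S" using D(2) mS by simp
    ultimately show ?thesis unfolding slack_def by blast
  next
    case 3
    \<comment> \<open>With \<open>x\<close> among the chosen vertices, \<open>h\<close> is dominated
      and nothing has to be added.\<close>
    obtain D where D: "isolates (S - Q) D" "x \<in> D" "6 * card D = m (S - Q) + 1"
      using extremal_through[OF SV 3 e(3)] by blast
    have "isolates S D"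
      by (rule key) (use D(1) hx[OF D(2)] isolatesD[OF D(1)] in \<open>auto simp: isolates_def\<close>)
    thus ?thesis using D(3) mS unfolding slack_def by (intro exI[of _ D]) simp
  qed
qed

section \<open>Maximum degree at most two\<close>

definition nbrs :: "'a set \<Rightarrow> 'a \<Rightarrow> 'a set" where
  "nbrs S v = {u \<in> S. {v, u} \<in> E}"

text \<open>A cycle uses up both edges at each of its vertices, so no edge of \<open>S\<close>
  leaves it or is a chord; connectedness then makes it all of \<open>S\<close>.\<close>

lemma max_degree_two:
  assumes S: "S \<subseteq> V" "conn S" and deg: "\<And>z. z \<in> S \<Longrightarrow> card (nbrs S z) \<le> 2"
    and K: "subgraph_of K G" "verts K \<subseteq> S" "n \<ge> 3" "graph_iso K (cycle_graph n)"
  shows "K = induced S"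
proof -
  define C where "C = verts K"
  have fS: "finite S" using S(1) finite_sub by blast
  have KE: "edges K \<subseteq> E" "simple_graph K" using K(1) by (auto simp: subgraph_of_def)
  have cC: "card C = n" using graph_iso_card_verts[OF K(4)] by (simp add: C_def)
  have closed: "u \<in> C \<and> {z, u} \<in> edges K" if z: "z \<in> C" "u \<in> S" "{z, u} \<in> E" for z u
  proof -
    have "C - {z} \<noteq> {}"
    proof
      assume "C - {z} = {}"
      hence "C \<subseteq> {z}" by auto
      hence "card C \<le> 1" using card_mono[of "{z}" C] by simp
      thus False using cC K(3) by simp
    qed
    hence "2 \<le> card (edges K \<inter> crossing (C \<inter> {z}) (C - {z}))"
      using subgraph_cycle_cut[OF K(4,3), of "{z}"] z(1) KE by (simp add: C_def)
    then obtain M where "M \<subseteq> edges K \<inter> crossing (C \<inter> {z}) (C - {z})" "card M = 2"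
      by (meson obtain_subset_with_card_n)
    then obtain e f where ef: "e \<noteq> f" "e \<in> edges K" "f \<in> edges K"
      "e \<in> crossing (C \<inter> {z}) (C - {z})" "f \<in> crossing (C \<inter> {z}) (C - {z})" by (auto simp: card_2_iff)
    obtain p where p: "e = {z, p}" "p \<in> C" "{z, p} \<in> E" using ef(4) by (auto elim!: crossingE)
    obtain q where q: "f = {z, q}" "q \<in> C" "{z, q} \<in> E" using ef(5) by (auto elim!: crossingE)
    have "p \<noteq> q" using ef(1) p(1) q(1) by auto
    have zS: "z \<in> S" "p \<in> S" "q \<in> S" using z(1) p(2) q(2) K(2) by (auto simp: C_def)
    have "{p, q} \<subseteq> nbrs S z" using p q zS by (simp add: nbrs_def)
    moreover have "finite (nbrs S z)" using fS by (simp add: nbrs_def)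
    ultimately have "{p, q} = nbrs S z" using deg[OF zS(1)] \<open>p \<noteq> q\<close> card_mono[of "nbrs S z" "{p, q}"]
      by (intro card_subset_eq) auto
    hence "u \<in> {p, q}" using z by (simp add: nbrs_def)
    thus ?thesis using p q ef by auto
  qed
  have "C = S"
  proof (rule ccontr)
    assume "C \<noteq> S"
    moreover have "C \<noteq> {}" using cC K(3) by auto
    moreover have CS: "C \<subseteq> S" using K(2) by (simp add: C_def)
    ultimately obtain p q where "p \<in> C" "q \<in> S - C" "{p, q} \<in> E" using conn_cut[OF S(2), of C] by blast
    thus False using closed by blast
  qed
  have "edges K = edges_in S"
  proof
    show "edges K \<subseteq> edges_in S" using KE K(2) by (auto simp: edges_in_def simple_graph_def)
    show "edges_in S \<subseteq> edges K"
    proof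
      fix e assume "e \<in> edges_in S"
      hence e: "e \<in> E" "e \<subseteq> S" by (auto simp: edges_in_def)
      obtain a b where "e = {a, b}" using e(1) edgeE by metis
      thus "e \<in> edges K" using closed[of a b] e \<open>C = S\<close> by auto
    qed
  qed
  thus ?thesis using \<open>C = S\<close> by (simp add: C_def induced_def)
qed

lemma max_degree_two_case:
  assumes S: "S \<subseteq> V" "conn S" and deg: "\<And>z. z \<in> S \<Longrightarrow> card (nbrs S z) \<le> 2"
  shows "square S \<or> slack S \<or> extremal S"
proof (cases "\<exists>C. cycle_set 4 C \<and> C \<subseteq> S")
  case False
  hence "isolates S {}" by (auto simp: isolates_def)
  thus ?thesis unfolding slack_def by (metis card.empty le0 mult_0_right)
next
  case True
  then obtain K n where K: "subgraph_of K G" "verts K \<subseteq> S" "n \<ge> 4" "graph_iso K (cycle_graph n)"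
    by (auto simp: cycle_set_def)
  hence isolates: "graph_iso (induced S) (cycle_graph n)" using max_degree_two[OF S deg, of K n] by auto
  hence mS: "m S = n" using graph_iso_card_edges[OF simple_induced[OF S(1)] _ isolates] K(3)
    by (simp add: simple_cycle_graph card_cycle_graph_edges)
  consider "n = 4" | "n = 5" | "n \<ge> 6" using K(3) by linarith
  thus ?thesis
  proof cases
    case 3
    obtain z where z: "z \<in> S" using S(2) by (auto simp: conn_def)
    \<comment> \<open>\<open>S\<close> itself is the only cycle to be met, so any vertex will do;
      its cost is covered by the \<open>n \<ge> 6\<close> edges.\<close>
    have "isolates S {z}"
      unfolding isolates_def
    proof (intro conjI allI impI)
      fix C assume C: "cycle_set 4 C" "C \<subseteq> S"
      then obtain K' n' where K': "subgraph_of K' G" "verts K' = C" "n' \<ge> 4" "graph_iso K' (cycle_graph n')"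
        by (auto simp: cycle_set_def)
      hence "K' = induced S" using max_degree_two[OF S deg, of K' n'] C(2) by auto
      hence "C = S" using K'(2) by simp
      thus "C \<inter> N {z} \<noteq> {}" using z by (auto simp: N_iff)
    qed (use z in auto)
    thus ?thesis using mS 3 unfolding slack_def by (intro disjI2 disjI1 exI[of _ "{z}"]) simp
  qed (use isolates in \<open>auto simp: extremal_def\<close>)
qed

section \<open>Isolating the components without choosing the centre\<close>

lemma card_crossing_vertex:
  assumes "S \<subseteq> V" "Y \<subseteq> S" "card (nbrs S h) \<le> 3" "p \<noteq> q" "p \<in> S - Y" "q \<in> S - Y" "{h, p} \<in> E" "{h, q} \<in> E"
  shows "card (crossing {h} Y) \<le> 1"
proof -
  have fS: "finite (nbrs S h)" using finite_sub[OF assms(1)] by (simp add: nbrs_def)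
  have "crossing {h} Y \<subseteq> (\<lambda>y. {h, y}) ` (nbrs S h - {p, q})"
  proof
    fix e assume "e \<in> crossing {h} Y"
    then obtain x y where "e = {x, y}" "x \<in> {h}" "y \<in> Y" "{x, y} \<in> E" by (rule crossingE)
    thus "e \<in> (\<lambda>y. {h, y}) ` (nbrs S h - {p, q})" using assms by (auto simp: nbrs_def)
  qed
  hence "card (crossing {h} Y) \<le> card (nbrs S h - {p, q})" using fS by (meson finite_Diff surj_card_le)
  also have "\<dots> = card (nbrs S h) - card {p, q}"
    using assms by (intro card_Diff_subset) (auto simp: nbrs_def)
  finally show ?thesis using assms(3,4) by simp
qed

text \<open>If \<open>v\<close> is not chosen, then each component must be isolated so that at most one of its links to
  \<open>X\<close> survives, since then no cycle can leave the component.\<close>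

lemma cheap_union:
  assumes S: "S \<subseteq> V" "X \<subseteq> S" "components (S - X) P" and X: "\<And>C. cycle_set 3 C \<Longrightarrow> \<not> C \<subseteq> X"
    and H: "\<And>H. H \<in> P \<Longrightarrow> \<exists>D. isolates H D \<and> card {e \<in> crossing H X. e \<inter> N D = {}} \<le> 1 \<and>
      6 * card D \<le> m H + card (crossing H X)"
  shows "slack S"
proof -
  have "\<forall>H\<in>P. \<exists>D. isolates H D \<and> card {e \<in> crossing H X. e \<inter> N D = {}} \<le> 1 \<and>
      6 * card D \<le> m H + card (crossing H X)" using H by (rule ballI)
  from bchoice[OF this] obtain f where f0: "\<forall>H\<in>P. isolates H (f H) \<and>
      card {e \<in> crossing H X. e \<inter> N (f H) = {}} \<le> 1 \<and> 6 * card (f H) \<le> m H + card (crossing H X)" ..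
  have f: "isolates H (f H)" "card {e \<in> crossing H X. e \<inter> N (f H) = {}} \<le> 1"
    "6 * card (f H) \<le> m H + card (crossing H X)" if "H \<in> P" for H
    using bspec[OF f0 that] by simp_all
  define D where "D = (\<Union>H\<in>P. f H)"
  have fP: "finite P" using S(3) by (simp add: components_def)
  have "isolates S D"
    unfolding isolates_def
  proof (intro conjI allI impI)
    have "f H \<subseteq> S" if "H \<in> P" for H
      using f(1)[OF that] component_subset[OF S(3) that] unfolding isolates_def by blast
    thus "D \<subseteq> S" unfolding D_def by blast
    fix C assume C: "cycle_set 4 C" "C \<subseteq> S"
    have C3: "cycle_set 3 C" using cycle_set_mono[OF C(1)] by simp
    show "C \<inter> N D \<noteq> {}"
    proof
      assume C0: "C \<inter> N D = {}"
      have "C \<inter> H = {}" if "H \<in> P" for H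
      proof -
        have "N (f H) \<subseteq> N D" by (rule N_mono) (use that in \<open>auto simp: D_def\<close>)
        hence CH: "C \<inter> N (f H) = {}" using C0 by blast
        have XS: "X \<union> (S - X) = S" using S(2) by auto
        have bdH: "crossing H (S - H) = crossing H X" using component_crossing[OF S(3) that, of X] XS by auto
        have "C \<subseteq> H \<or> C \<inter> H = {}"
        proof (rule cycle_set_separated[OF C3 f(2)[OF that]])
          have "crossing (C \<inter> H) (C - H) \<subseteq> crossing H X" unfolding bdH[symmetric] using C(2) by (intro crossing_mono) auto
          moreover have "e \<inter> N (f H) = {}" if "e \<in> crossing (C \<inter> H) (C - H)" for e
            using that CH by (auto elim!: crossingE)
          ultimately show "crossing (C \<inter> H) (C - H) \<subseteq> {e \<in> crossing H X. e \<inter> N (f H) = {}}" by blast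
        qed auto
        thus ?thesis using isolatesD[OF f(1)[OF that] C(1)] CH by blast
      qed
      hence "C \<subseteq> X" using C(2) component_cover[OF S(3)] by blast
      thus False using X[OF C3] by blast
    qed
  qed
  moreover have "6 * card D \<le> m S"
  proof -
    have "6 * card D \<le> 6 * (\<Sum>H\<in>P. card (f H))" unfolding D_def using card_UN_le[OF fP, of f] by simp
    also have "\<dots> = (\<Sum>H\<in>P. 6 * card (f H))" by (simp add: sum_distrib_left)
    also have "\<dots> \<le> (\<Sum>H\<in>P. m H + card (crossing H X))" using f(3) by (intro sum_mono)
    also have "\<dots> \<le> m S" using m_delete[OF S(3,2)] by simp
    finally show ?thesis .
  qed
  ultimately show ?thesis unfolding slack_def by blast
qed

lemma card_endpoints:
  assumes "A \<inter> B = {}"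
  shows "card (\<Union>e\<in>crossing A B. e \<inter> A) \<le> card (crossing A B)"
proof -
  have "card (e \<inter> A) \<le> 1" if e: "e \<in> crossing A B" for e
  proof -
    obtain a b where "e = {a, b}" "a \<in> A" "b \<in> B" by (rule crossingE[OF e])
    hence "e \<inter> A \<subseteq> {a}" using assms by auto
    thus ?thesis using card_mono[of "{a}" "e \<inter> A"] by simp
  qed
  hence "(\<Sum>e\<in>crossing A B. card (e \<inter> A)) \<le> (\<Sum>e\<in>crossing A B. 1)" by (rule sum_mono)
  thus ?thesis using card_UN_le[of "crossing A B" "\<lambda>e. e \<inter> A"] by simp
qed

text \<open>\<open>b\<close> is the one undominated vertex that may keep links, and \<open>U\<close>
  collects undominated vertices without links; so every surviving link starts at
  \<open>b\<close>.\<close>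

lemma surviving_single:
  assumes "H \<inter> X = {}" "H \<subseteq> N D \<union> {b} \<union> U" "card (crossing {b} X) \<le> 1" "\<And>u. u \<in> U \<Longrightarrow> crossing {u} X = {}"
  shows "card {e \<in> crossing H X. e \<inter> N D = {}} \<le> 1"
proof -
  have "{e \<in> crossing H X. e \<inter> N D = {}} \<subseteq> crossing {b} X"
  proof
    fix e assume "e \<in> {e \<in> crossing H X. e \<inter> N D = {}}"
    hence e: "e \<in> crossing H X" "e \<inter> N D = {}" by auto
    then obtain x y where xy: "e = {x, y}" "x \<in> H" "y \<in> X" "{x, y} \<in> E" by (auto elim: crossingE)
    have "x \<notin> U"
    proof
      assume "x \<in> U"
      hence "crossing {x} X = {}" by (rule assms(4))
      thus False using crossingI[OF xy(4), of "{x}" X] xy(3) by auto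
    qed
    hence "x = b" using xy e(2) assms(2) by auto
    thus "e \<in> crossing {b} X" using xy by (simp add: crossingI)
  qed
  hence "card {e \<in> crossing H X. e \<inter> N D = {}} \<le> card (crossing {b} X)" by (intro card_mono) auto
  thus ?thesis using assms(3) by simp
qed

lemma isolates_if_few_left:
  assumes "D \<subseteq> H" "H \<subseteq> N D \<union> A" "finite A" "card A < 4"
  shows "isolates H D"
  unfolding isolates_def
proof (intro conjI allI impI)
  fix C assume C: "cycle_set 4 C" "C \<subseteq> H"
  show "C \<inter> N D \<noteq> {}"
  proof
    assume "C \<inter> N D = {}"
    hence "C \<subseteq> A" using C(2) assms(2) by blast
    thus False using no_long_cycle_if_small[OF assms(3,4)] C(1) by blast
  qed
qed fact

text \<open>Any vertex \<open>h\<close> will do: only the opposite vertex \<open>b\<close> can stay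
  undominated, and with two of its at most three edges inside \<open>H\<close> it has at most one
  link. The cost is \<open>6 \<le> 4 + 2\<close>.\<close>

lemma cheap_square:
  assumes S: "S \<subseteq> V" "X \<subseteq> S" "H \<subseteq> S - X" "\<And>z. z \<in> S \<Longrightarrow> card (nbrs S z) \<le> 3"
    and H: "square H" "2 \<le> card (crossing H X)"
  shows "\<exists>D. isolates H D \<and> card {e \<in> crossing H X. e \<inter> N D = {}} \<le> 1 \<and> 6 * card D \<le> m H + card (crossing H X)"
proof -
  obtain h where h: "h \<in> H" using square_card[OF H(1)] by fastforce
  obtain a b c where q: "H = {h, a, b, c}" "distinct [h, a, b, c]"
    "{h, a} \<in> E" "{h, c} \<in> E" "{b, a} \<in> E" "{b, c} \<in> E" by (rule square_vertex[OF H(1) h])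
  have "card (crossing {b} X) \<le> 1"
    by (rule card_crossing_vertex[OF S(1,2), of b a c]) (use S q in auto)
  moreover have "H \<subseteq> N {h} \<union> {b} \<union> {}" using q by (auto simp: N_iff)
  ultimately have "card {e \<in> crossing H X. e \<inter> N {h} = {}} \<le> 1"
    using S(3) by (intro surviving_single[of H X "{h}" b "{}"]) auto
  moreover have "isolates H {h}" using square_through[OF H(1) h] .
  moreover have "m H = 4" using square_card_edges[OF _ H(1)] S by auto
  ultimately show ?thesis using H(2) by (intro exI[of _ "{h}"]) simp
qed

text \<open>Prescribing the end \<open>u\<close> of one link destroys that link and leaves at most
  the other; the cost \<open>m H + 1\<close> is within \<open>m H + 2\<close>.\<close>

lemma cheap_extremal_two:
  assumes S: "S \<subseteq> V" "H \<subseteq> S" and H: "extremal H" "card (crossing H X) = 2"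
  shows "\<exists>D. isolates H D \<and> card {e \<in> crossing H X. e \<inter> N D = {}} \<le> 1 \<and> 6 * card D \<le> m H + card (crossing H X)"
proof -
  have "crossing H X \<noteq> {}" using H(2) by auto
  then obtain e where e0: "e \<in> crossing H X" by blast
  then obtain u x where e: "e = {u, x}" "u \<in> H" by (auto elim: crossingE)
  obtain D where D: "isolates H D" "u \<in> D" "6 * card D = m H + 1" using extremal_through[OF _ H(1) e(2)] S by blast
  have "{e \<in> crossing H X. e \<inter> N D = {}} \<subseteq> crossing H X - {e}" using e D(2) by (auto simp: N_iff)
  hence "card {e \<in> crossing H X. e \<inter> N D = {}} \<le> card (crossing H X - {e})" by (intro card_mono) auto
  also have "\<dots> = 1" using H(2) e0 by simp
  finally show ?thesis using D H(2) by auto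
qed

text \<open>A prescribed end might leave two of the three links. Instead a single vertex is picked
  that leaves at most one; this is affordable because every graph that occurs turns out to have five
  edges, and \<open>6 \<le> 5 + 3\<close>.\<close>

lemma cheap_extremal_three:
  assumes S: "S \<subseteq> V" "X \<subseteq> S" "H \<subseteq> S - X" "X \<noteq> {}" "bridgeless S" "\<And>z. z \<in> S \<Longrightarrow> card (nbrs S z) \<le> 3"
    and nosq: "\<And>Q. Q \<subseteq> S \<Longrightarrow> square Q \<Longrightarrow> card (crossing Q (S - Q)) \<noteq> 2"
    and H: "extremal H" "card (crossing H X) = 3" "crossing H (S - H) = crossing H X"
  shows "\<exists>D. isolates H D \<and> card {e \<in> crossing H X. e \<inter> N D = {}} \<le> 1 \<and> 6 * card D \<le> m H + card (crossing H X)"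
proof -
  have HX: "H \<inter> X = {}" and HV: "H \<subseteq> V" using S by auto
  have fin: "isolates H {z} \<Longrightarrow> card {e \<in> crossing H X. e \<inter> N {z} = {}} \<le> 1 \<Longrightarrow> 3 \<le> m H \<Longrightarrow> ?thesis" for z
    using H(2) by (intro exI[of _ "{z}"]) auto
  consider T F w where "pure_special H T F w" | "diamond H" | "pentagon H" using H(1) unfolding extremal_def by blast
  thus ?thesis
  proof cases
    case 1
    note p = this
    have fT: "finite T" using pure_special_sub[OF p] HV finite_sub by blast
    \<comment> \<open>each square has at least three outgoing edges, one of which goes to its tree vertex; so \<open>T\<close> is a singleton\<close>
    have two: "2 \<le> card (crossing (F t) X)" if t: "t \<in> T" for t
    proof -
      have Ft: "F t \<subseteq> S - X" "square (F t)" using pure_special_F_sub[OF p t] S(3) pure_special_sq[OF p t] by auto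
      have "F t \<noteq> {}" "F t \<noteq> S" "F t \<subseteq> S" using pure_special_w[OF p t] Ft S(2,4) by auto
      hence "2 \<le> card (crossing (F t) (S - F t))" using S(5) unfolding bridgeless_def by blast
      hence "3 \<le> card (crossing (F t) (S - F t))" using nosq[OF \<open>F t \<subseteq> S\<close> Ft(2)] by linarith
      also have "crossing (F t) (S - F t) \<subseteq> insert {t, w t} (crossing (F t) X)"
      proof
        fix e assume "e \<in> crossing (F t) (S - F t)"
        then obtain x y where e: "e = {x, y}" "x \<in> F t" "y \<in> S - F t" "{x, y} \<in> E" by (rule crossingE)
        have xH: "x \<in> H" using e(2) pure_special_F_sub[OF p t] by auto
        show "e \<in> insert {t, w t} (crossing (F t) X)"
        proof (cases "y \<in> H")
          case True
          hence "e \<in> crossing (F t) (H - F t)" using e by (simp add: crossingI)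
          thus ?thesis using pure_special_square_crossing[OF p t] by simp
        next
          case False
          hence "e \<in> crossing H (S - H)" using e xH by (simp add: crossingI)
          hence "e \<in> crossing H X" using H(3) by simp
          then obtain x' y' where e': "e = {x', y'}" "x' \<in> H" "y' \<in> X" by (auto elim: crossingE)
          hence "y = y'" using e(1) xH HX by (auto simp: doubleton_eq_iff)
          thus ?thesis using e e' by (simp add: crossingI)
        qed
      qed
      hence "card (crossing (F t) (S - F t)) \<le> card (insert {t, w t} (crossing (F t) X))" by (intro card_mono) auto
      also have "\<dots> \<le> Suc (card (crossing (F t) X))" by (simp add: card_insert_if)
      finally show ?thesis by simp
    qed
    have "2 * card T = (\<Sum>t\<in>T. 2)" by simp
    also have "\<dots> \<le> (\<Sum>t\<in>T. card (crossing (F t) X))" using two by (rule sum_mono)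
    also have "\<dots> = card (\<Union>t\<in>T. crossing (F t) X)"
    proof (rule card_UN_disjoint[symmetric])
      show "\<forall>i\<in>T. \<forall>j\<in>T. i \<noteq> j \<longrightarrow> crossing (F i) X \<inter> crossing (F j) X = {}"
      proof (intro ballI impI)
        fix i j assume ij: "i \<in> T" "j \<in> T" "i \<noteq> j"
        have "F i \<inter> F j = {}" "F i \<inter> X = {}" "F j \<inter> X = {}"
          using pure_special_disj[OF p ij] pure_special_F_sub[OF p ij(1)] pure_special_F_sub[OF p ij(2)] HX by auto
        thus "crossing (F i) X \<inter> crossing (F j) X = {}" by (auto simp: crossing_def doubleton_eq_iff dest: IntI)
      qed
    qed (use fT in auto)
    also have "\<dots> \<le> card (crossing H X)"
      using pure_special_F_sub[OF p] by (intro card_mono UN_least crossing_mono) auto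
    finally have "card T \<le> 1" using H(2) by simp
    moreover have "card T \<noteq> 0" using pure_specialD(1)[OF p] fT by simp
    ultimately have "card T = 1" by simp
    then obtain t where T: "T = {t}" by (rule card_1_singletonE)
    hence t: "t \<in> T" by simp
    obtain a b c where q: "F t = {w t, a, b, c}" "distinct [w t, a, b, c]"
      "{w t, a} \<in> E" "{w t, c} \<in> E" "{b, a} \<in> E" "{b, c} \<in> E"
      by (rule square_vertex[OF pure_special_sq[OF p t] pure_special_w[OF p t]])
    have FH: "F t \<subseteq> H" using pure_special_F_sub[OF p t] .
    have "H = {t} \<union> F t" using pure_specialD(2)[OF p] T by simp
    \<comment> \<open>\<open>w t\<close> dominates its tree vertex and the square except possibly
      for the opposite vertex \<open>b\<close>.\<close>
    hence HN: "H \<subseteq> N {w t} \<union> {b}" using q pure_special_edge[OF p t] by (auto simp: N_iff insert_commute)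
    have wH: "w t \<in> H" using pure_special_w[OF p t] FH by auto
    have "card (crossing {b} X) \<le> 1"
      by (rule card_crossing_vertex[OF S(1,2), of b a c]) (use S(3) S(6)[of b] q FH in auto)
    hence "card {e \<in> crossing H X. e \<inter> N {w t} = {}} \<le> 1"
      using HN by (intro surviving_single[of H X "{w t}" b "{}"] HX) auto
    moreover have "isolates H {w t}" using HN wH by (intro isolates_if_few_left[of _ _ "{b}"]) auto
    moreover have "m H = 5" using pure_specialD(8)[OF p] T by simp
    ultimately show ?thesis by (intro fin) auto
  next
    case 2
    obtain z where z: "z \<in> H" "H \<subseteq> N {z}" by (rule diamond_centre[OF 2])
    have "e \<inter> N {z} \<noteq> {}" if "e \<in> crossing H X" for e using that z(2) by (auto elim!: crossingE)
    hence e0: "{e \<in> crossing H X. e \<inter> N {z} = {}} = {}" by blast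
    have "isolates H {z}" using z by (intro isolates_if_few_left[of _ _ "{}"]) auto
    moreover have "card {e \<in> crossing H X. e \<inter> N {z} = {}} \<le> 1" unfolding e0 by simp
    ultimately show ?thesis using diamond_card_edges[OF HV 2] by (intro fin) simp_all
  next
    case 3
    \<comment> \<open>Three links cannot touch all five vertices.\<close>
    have "\<exists>p\<in>H. crossing {p} X = {}"
    proof (rule ccontr)
      assume neg: "\<not> ?thesis"
      have "H \<subseteq> (\<Union>e\<in>crossing H X. e \<inter> H)"
      proof
        fix p assume pH: "p \<in> H"
        then obtain e where "e \<in> crossing {p} X" using neg by blast
        then obtain y where y: "y \<in> X" "{p, y} \<in> E" by (auto elim: crossingE)
        thus "p \<in> (\<Union>e\<in>crossing H X. e \<inter> H)" using crossingI[OF y(2) pH y(1)] pH by auto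
      qed
      moreover have "finite (\<Union>e\<in>crossing H X. e \<inter> H)" using HV finite_sub by auto
      ultimately have "card H \<le> card (\<Union>e\<in>crossing H X. e \<inter> H)" by (rule card_mono[rotated])
      thus False using card_endpoints[OF HX] pentagon_card[OF 3] H(2) by simp
    qed
    then obtain p where p: "p \<in> H" "crossing {p} X = {}" by blast
    obtain a b c d where q: "H = {p, a, b, c, d}" "distinct [p, a, b, c, d]"
      "{p, a} \<in> E" "{a, b} \<in> E" "{b, c} \<in> E" "{c, d} \<in> E" "{d, p} \<in> E"
      by (rule pentagon_vertex[OF 3 p(1)])
    \<comment> \<open>\<open>b\<close> has distance two from \<open>p\<close> and misses only
      \<open>p\<close>, which has no link, and its neighbour \<open>d\<close>, which has two edges
      inside \<open>H\<close>.\<close>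
    have HN: "H \<subseteq> N {b} \<union> {d} \<union> {p}" using q by (auto simp: N_iff insert_commute)
    have "card (crossing {d} X) \<le> 1"
      by (rule card_crossing_vertex[OF S(1,2), of d c p]) (use S(3) S(6)[of d] q in \<open>auto simp: insert_commute\<close>)
    hence "card {e \<in> crossing H X. e \<inter> N {b} = {}} \<le> 1"
      using HN p(2) by (intro surviving_single[of H X "{b}" d "{p}"] HX) auto
    moreover have "isolates H {b}"
      using HN q by (intro isolates_if_few_left[of _ _ "{d, p}"]) (auto simp: card_insert_if)
    ultimately show ?thesis using pentagon_card_edges[OF HV 3] by (intro fin) auto
  qed
qed

section \<open>A vertex of degree at least three in a bridgeless graph\<close>

lemma diamond_intro:
  assumes "distinct [v, a, b, c]" "{v, a} \<in> E" "{v, b} \<in> E" "{v, c} \<in> E" "{a, b} \<in> E" "{b, c} \<in> E" "{a, c} \<notin> E"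
  shows "diamond {v, a, b, c}"
proof -
  \<comment> \<open>\<open>v\<close> and \<open>b\<close> become the ends of the chord
    \<open>13\<close>, while \<open>a\<close> and \<open>c\<close> are the vertices of degree
    two.\<close>
  define f where "f = (\<lambda>x. if x = v then 1 else if x = a then 2 else if x = b then 3 else (4::nat))"
  have f: "f v = 1" "f a = 2" "f b = 3" "f c = 4" using assms(1) by (auto simp: f_def)
  have "bij_betw f {v, a, b, c} {1, 2, 3, 4}"
    unfolding bij_betw_def inj_on_def using f by auto
  moreover have "{u, w} \<in> edges_in {v, a, b, c} \<longleftrightarrow> {f u, f w} \<in> edges diamond_graph"
    if "u \<in> {v, a, b, c}" "w \<in> {v, a, b, c}" for u w
    using that assms f
    by (elim insertE emptyE)
      (simp_all add: in_edges_in diamond_graph_def insert_commute doubleton_eq_iff, simp_all add: edges_in_def)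
  ultimately show ?thesis by (auto simp: graph_iso_def diamond_graph_def)
qed

text \<open>As \<open>A\<close> is independent, a vertex of \<open>A\<close> has at most the
  neighbour \<open>v\<close> on the cycle, where it would need two.\<close>

lemma star_acyclic:
  assumes "edges_in A = {}" "cycle_set 3 C"
  shows "\<not> C \<subseteq> insert v A"
proof
  assume C: "C \<subseteq> insert v A"
  have "C - {v} \<noteq> {}"
  proof
    assume "C - {v} = {}"
    hence "C \<subseteq> {v}" by auto
    thus False using cycle_set_subset_card[OF assms(2), of "{v}"] by simp
  qed
  then obtain x where x: "x \<in> C" "x \<in> A" using C by auto
  obtain y z where yz: "y \<noteq> z" "y \<in> C" "z \<in> C" "{x, y} \<in> E" "{x, z} \<in> E" by (rule cycle_set_degree[OF assms(2) x(1)])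
  have "u = v" if "u \<in> C" "{x, u} \<in> E" for u
  proof (rule ccontr)
    assume "u \<noteq> v"
    hence "{x, u} \<in> edges_in A" using that x C by (auto simp: in_edges_in)
    thus False using assms(1) by simp
  qed
  thus False using yz by blast
qed

lemma max_degree_ge_three_case:
  assumes S: "S \<subseteq> V" "conn S" "smaller_ok S" "bridgeless S"
    and v: "v \<in> S" "3 \<le> card (nbrs S v)" "\<And>z. z \<in> S \<Longrightarrow> card (nbrs S z) \<le> card (nbrs S v)"
  shows "slack S \<or> extremal S"
proof (rule ccontr)
  assume "\<not> ?thesis"
  hence nvg: "\<not> slack S" and nex: "\<not> extremal S" by auto
  define A where "A = nbrs S v"
  define X where "X = insert v A"
  have fS: "finite S" using S(1) finite_sub by blast
  have AS: "A \<subseteq> S" "v \<notin> A" by (auto simp: A_def nbrs_def)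
  have adjA: "{v, a} \<in> E" if "a \<in> A" for a using that by (simp add: A_def nbrs_def)
  have fA: "finite A" using AS(1) fS finite_subset by blast
  have XS: "X \<subseteq> S" "X \<noteq> {}" "v \<in> X" using AS v(1) by (auto simp: X_def)
  have XR: "X \<union> (S - X) = S" using XS by auto
  obtain P where P: "components (S - X) P" using components_exist[of "S - X"] fS by blast
  have fP: "finite P" using P by (simp add: components_def)
  have mX: "m X = card A + m A"
  proof -
    have "crossing {v} A = (\<lambda>a. {v, a}) ` A" using adjA by (auto simp: crossing_def)
    moreover have "inj_on (\<lambda>a. {v, a}) A" by (auto simp: inj_on_def doubleton_eq_iff)
    ultimately have "card (crossing {v} A) = card A" by (simp add: card_image)
    thus ?thesis using card_edges_in_Un[of "{v}" A] AS(2) by (simp add: X_def)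
  qed
  define d where "d H = card (crossing H X)" for H
  have bdH: "crossing H (S - H) = crossing H X" if "H \<in> P" for H
    using component_crossing[OF P that, of X] XR by auto
  have HS: "H \<subseteq> S - X" "H \<noteq> {}" "H \<subset> S" "H \<subseteq> V" "conn H" if "H \<in> P" for H
  proof -
    show 1: "H \<subseteq> S - X" using component_subset[OF P that] .
    show "H \<noteq> {}" using component_nonempty[OF P that] .
    show "H \<subset> S" using 1 XS by auto
    show "H \<subseteq> V" using 1 S(1) by auto
    show "conn H" using P that by (simp add: components_def)
  qed
  have d2: "2 \<le> d H" if "H \<in> P" for H
  proof -
    have "2 \<le> card (crossing H (S - H))"
      using S(4) HS(2,3)[OF that] unfolding bridgeless_def by blast
    thus ?thesis using bdH[OF that] by (simp add: d_def)
  qed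
  have nosq: "card (crossing Q (S - Q)) \<noteq> 2" if "Q \<subseteq> S" "square Q" for Q
    using square_two_edges[OF S(1,3,4) that(2,1)] nvg by blast
  have d3: "3 \<le> d H" if "H \<in> P" "square H" for H
    using d2[OF that(1)] nosq[of H] HS(3)[OF that(1)] that bdH[OF that(1)] by (force simp: d_def)
  have kinds: "square H \<or> slack H \<or> extremal H" if "H \<in> P" for H
    using smaller_okD[OF S(3) HS(3)[OF that] HS(5)[OF that]] .
  \<comment> \<open>The gain: the links, minus the one or two units by which an extremal graph or a
    square overspends. \<open>slack\<close> is tested first because it gives the most.\<close>
  define g where "g H = (if slack H then d H else if extremal H then d H - 1 else d H - 2)" for H
  have g1: "1 \<le> g H" "d H \<le> g H + 2" if "H \<in> P" for H
    using d2[OF that] d3[OF that] kinds[OF that] by (auto simp: g_def)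
  have cost: "\<exists>D\<subseteq>H. (\<forall>C. cycle_set 4 C \<longrightarrow> C \<subseteq> H \<longrightarrow> C \<inter> (N D \<union> N {v}) \<noteq> {}) \<and>
        6 * card D + g H \<le> m H + card (crossing H X)" if H: "H \<in> P" for H
  proof -
    have "\<exists>D. isolates H D \<and> 6 * card D + g H \<le> m H + d H"
    proof -
      consider "slack H" | "\<not> slack H" "extremal H" | "\<not> slack H" "\<not> extremal H" "square H" using kinds[OF H] by blast
      thus ?thesis
      proof cases
        case 1
        then obtain D where "isolates H D" "6 * card D \<le> m H" unfolding slack_def by blast
        thus ?thesis using 1 by (intro exI[of _ D]) (simp add: g_def)
      next
        case 2
        obtain D where "isolates H D" "6 * card D = m H + 1" using extremal_isolates[OF HS(4)[OF H] 2(2)] by blast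
        thus ?thesis using 2 d2[OF H] by (intro exI[of _ D]) (simp add: g_def)
      next
        case 3
        obtain h where "h \<in> H" using HS(2)[OF H] by blast
        hence "isolates H {h}" using square_through[OF 3(3)] by blast
        thus ?thesis using 3 d3[OF H 3(3)] square_card_edges[OF HS(4)[OF H] 3(3)]
          by (intro exI[of _ "{h}"]) (simp add: g_def)
      qed
    qed
    then obtain D where D: "isolates H D" "6 * card D + g H \<le> m H + d H" by blast
    have "D \<subseteq> H" using D(1) unfolding isolates_def by blast
    moreover have "C \<inter> (N D \<union> N {v}) \<noteq> {}" if "cycle_set 4 C" "C \<subseteq> H" for C
      using isolatesD[OF D(1) that] by blast
    ultimately show ?thesis using D(2) unfolding d_def by blast
  qed
  have tot: "card A + m A + (\<Sum>H\<in>P. g H) \<le> 5"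
  proof (rule ccontr)
    assume "\<not> ?thesis"
    hence "6 \<le> m X + (\<Sum>H\<in>P. g H)" using mX by simp
    moreover have "X \<subseteq> N {v}" using adjA by (auto simp: X_def N_iff)
    ultimately show False using slack_by_gain[OF S(1) v(1) _ XS(1) P cost] nvg by blast
  qed
  have second: "\<exists>z\<in>S. z \<noteq> v \<and> {a, z} \<in> E" if a: "a \<in> A" for a
  proof (rule ccontr)
    assume neg: "\<not> ?thesis"
    have "crossing {a} (S - {a}) \<subseteq> {{a, v}}" using neg by (auto simp: crossing_def)
    hence "card (crossing {a} (S - {a})) \<le> 1" using card_mono[of "{{a, v}}"] by fastforce
    moreover have "{a} \<subseteq> S" "{a} \<noteq> S" using a AS v(1) by auto
    hence "2 \<le> card (crossing {a} (S - {a}))" using S(4) unfolding bridgeless_def by blast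
    ultimately show False by simp
  qed
  \<comment> \<open>All neighbours of \<open>v\<close> lie in \<open>A\<close>, so every link of a
    component ends in \<open>A\<close> and never at \<open>v\<close>.\<close>
  have bdRA: "card (crossing (S - X) A) = (\<Sum>H\<in>P. d H)"
  proof -
    have "{r, v} \<notin> E" if "r \<in> S - X" for r
    proof
      assume "{r, v} \<in> E"
      hence "r \<in> A" using that by (simp add: A_def nbrs_def insert_commute)
      thus False using that by (simp add: X_def)
    qed
    hence "crossing (S - X) A = crossing (S - X) X" by (auto simp: crossing_def X_def)
    thus ?thesis using card_crossing_components[OF P, of X] by (auto simp: d_def)
  qed
  \<comment> \<open>every neighbour of \<open>v\<close> has a second edge, inside \<open>A\<close> or leaving it\<close>
  have k1: "card A \<le> 2 * m A + (\<Sum>H\<in>P. d H)"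
  proof -
    have "A \<subseteq> (\<Union>e\<in>edges_in A. e) \<union> (\<Union>e\<in>crossing A (S - X). e \<inter> A)"
    proof
      fix a assume a: "a \<in> A"
      obtain z where z: "z \<in> S" "z \<noteq> v" "{a, z} \<in> E" using second[OF a] by blast
      show "a \<in> (\<Union>e\<in>edges_in A. e) \<union> (\<Union>e\<in>crossing A (S - X). e \<inter> A)"
      proof (cases "z \<in> A")
        case True
        hence "{a, z} \<in> edges_in A" using a z by (simp add: in_edges_in)
        thus ?thesis by blast
      next
        case False
        hence "{a, z} \<in> crossing A (S - X)" using a z by (intro crossingI) (auto simp: X_def)
        thus ?thesis using a by blast
      qed
    qed
    moreover have "finite ((\<Union>e\<in>edges_in A. e) \<union> (\<Union>e\<in>crossing A (S - X). e \<inter> A))"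
    proof -
      have "(\<Union>e\<in>edges_in A. e) \<union> (\<Union>e\<in>crossing A (S - X). e \<inter> A) \<subseteq> A" by (auto simp: edges_in_def)
      thus ?thesis using fA finite_subset by blast
    qed
    ultimately have "card A \<le> card ((\<Union>e\<in>edges_in A. e) \<union> (\<Union>e\<in>crossing A (S - X). e \<inter> A))" by (rule card_mono[rotated])
    also have "\<dots> \<le> card (\<Union>e\<in>edges_in A. e) + card (\<Union>e\<in>crossing A (S - X). e \<inter> A)" by (rule card_Un_le)
    also have "card (\<Union>e\<in>edges_in A. e) \<le> (\<Sum>e\<in>edges_in A. card e)" by (rule card_UN_le) simp
    also have "\<dots> = (\<Sum>e\<in>edges_in A. 2)" by (rule sum.cong) (auto simp: edges_in_def edge_2)
    also have "\<dots> = 2 * m A" by simp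
    also have "card (\<Union>e\<in>crossing A (S - X). e \<inter> A) \<le> card (crossing A (S - X))"
      by (rule card_endpoints) (auto simp: X_def)
    also have "\<dots> = (\<Sum>H\<in>P. d H)" using bdRA crossing_sym[of A "S - X"] by simp
    finally show ?thesis by simp
  qed
  have cP: "card P \<le> (\<Sum>H\<in>P. g H)" using sum_mono[of P "\<lambda>_. 1" g] g1(1) by simp
  have "(\<Sum>H\<in>P. d H) \<le> (\<Sum>H\<in>P. g H + 2)" using g1(2) by (rule sum_mono)
  also have "\<dots> = (\<Sum>H\<in>P. g H) + 2 * card P" by (subst sum.distrib) simp
  finally have "(\<Sum>H\<in>P. d H) \<le> 3 * (\<Sum>H\<in>P. g H)" using cP by simp
  \<comment> \<open>The bounds combine to \<open>4 * card A \<le> 15\<close>.\<close>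
  hence cA: "card A = 3" using tot k1 v(2) by (simp add: A_def)
  have gtot: "m A + (\<Sum>H\<in>P. g H) \<le> 2" using tot cA by simp
  have deg3: "card (nbrs S z) \<le> 3" if "z \<in> S" for z using v(3)[OF that] cA by (simp add: A_def)
  have gle: "g H \<le> (\<Sum>H\<in>P. g H)" if "H \<in> P" for H using fP that by (intro member_le_sum) auto
  obtain a b c where abc: "A = {a, b, c}" "distinct [a, b, c]"
    using cA by (auto simp: card_3_iff)
  have adj: "{v, a} \<in> E" "{v, b} \<in> E" "{v, c} \<in> E" using adjA abc by auto
  have edA: "edges_in A \<subseteq> {{a, b}, {b, c}, {a, c}}"
  proof
    fix e assume "e \<in> edges_in A"
    hence e: "e \<in> E" "e \<subseteq> A" by (auto simp: edges_in_def)
    obtain x y where "e = {x, y}" "x \<noteq> y" using e(1) edgeE by metis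
    thus "e \<in> {{a, b}, {b, c}, {a, c}}" using e(2) abc by auto
  qed
  have ab_iff: "{x, y} \<in> edges_in A \<longleftrightarrow> {x, y} \<in> E" if "x \<in> A" "y \<in> A" for x y using that by (simp add: in_edges_in)
  consider "m A = 0" | "m A = 1" | "m A = 2" using gtot by linarith
  thus False
  proof cases
    case 3
    \<comment> \<open>Two edges inside \<open>A\<close> exhaust the budget: there is no component,
      and \<open>v\<close> with its three neighbours is a diamond.\<close>
    hence "(\<Sum>H\<in>P. g H) = 0" using gtot by simp
    hence "card P = 0" using cP by simp
    hence "P = {}" using fP by simp
    hence "S - X = {}" using P by (simp add: components_def)
    hence SX: "S = {v, a, b, c}" using XS(1) abc by (auto simp: X_def)
    have vd: "v \<noteq> a" "v \<noteq> b" "v \<noteq> c" using AS(2) abc by auto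
    obtain e1 e2 where "edges_in A = {e1, e2}" "e1 \<noteq> e2" using 3 by (auto simp: card_2_iff)
    then consider "edges_in A = {{a, b}, {b, c}}" | "edges_in A = {{a, b}, {a, c}}" | "edges_in A = {{b, c}, {a, c}}"
      using edA by (auto simp: insert_commute)
    hence "diamond S"
    proof cases
      case 1
      hence "{a, b} \<in> E" "{b, c} \<in> E" "{a, c} \<notin> E"
        using ab_iff[of a b] ab_iff[of b c] ab_iff[of a c] abc by (auto simp: doubleton_eq_iff)
      hence "diamond {v, a, b, c}" using adj vd abc(2) by (intro diamond_intro) auto
      thus ?thesis using SX by simp
    next
      case 2
      hence "{b, a} \<in> E" "{a, c} \<in> E" "{b, c} \<notin> E"
        using ab_iff[of b a] ab_iff[of b c] ab_iff[of a c] abc by (auto simp: doubleton_eq_iff)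
      hence "diamond {v, b, a, c}" using adj vd abc(2) by (intro diamond_intro) auto
      thus ?thesis using SX by (simp add: insert_commute)
    next
      case 3
      hence "{a, c} \<in> E" "{c, b} \<in> E" "{a, b} \<notin> E"
        using ab_iff[of a b] ab_iff[of c b] ab_iff[of a c] abc by (auto simp: doubleton_eq_iff)
      hence "diamond {v, a, c, b}" using adj vd abc(2) by (intro diamond_intro) auto
      thus ?thesis using SX by (simp add: insert_commute)
    qed
    thus False using nex by (simp add: extremal_def)
  next
    case 2
    then obtain e where e: "edges_in A = {e}" by (rule card_1_singletonE)
    hence "e \<in> {{a, b}, {b, c}, {a, c}}" using edA by blast
    \<comment> \<open>With a single edge inside \<open>A\<close>, the neighbour \<open>x\<close> off
      that edge finds its second edge in a component; the remaining budget admits just one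
      component, with gain 1.\<close>
    then obtain x where x: "x \<in> A" "x \<notin> e" using abc by auto
    obtain z where z: "z \<in> S" "z \<noteq> v" "{x, z} \<in> E" using second[OF x(1)] by blast
    have "z \<notin> A"
    proof
      assume "z \<in> A"
      hence "{x, z} \<in> edges_in A" using x(1) z(3) by (simp add: in_edges_in)
      thus False using e x(2) by auto
    qed
    hence "z \<in> S - X" using z by (auto simp: X_def)
    then obtain H where H: "H \<in> P" "z \<in> H" by (rule component_cover[OF P])
    have sum1: "(\<Sum>H\<in>P. g H) = 1" using gtot 2 gle[OF H(1)] g1(1)[OF H(1)] by simp
    hence gH: "g H = 1" using gle[OF H(1)] g1(1)[OF H(1)] by simp
    have "P = {H}"
    proof -
      have "card P \<le> 1" using cP sum1 by simp
      thus ?thesis using H(1) fP card_le_Suc0_iff_eq[OF fP] by auto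
    qed
    hence SH: "S - X = H" using P by (simp add: components_def)
    have mS: "m S = m X + (m H + d H)" using m_delete[OF P XS(1)] \<open>P = {H}\<close> by (simp add: d_def)
    have Ax: "card (insert v (A - {x})) < 4" "finite (insert v (A - {x}))"
      using fA cA x(1) AS(2) by simp_all
    have zx: "{z, x} \<in> E" using z(3) by (simp add: insert_commute)
    have "\<not> slack H" using gH d2[OF H(1)] by (auto simp: g_def)
    hence "extremal H \<or> square H" using kinds[OF H(1)] by blast
    thus False
    proof
      assume ex: "extremal H"
      hence dH: "d H = 2" using gH \<open>\<not> slack H\<close> d2[OF H(1)] by (auto simp: g_def)
      \<comment> \<open>Choosing \<open>z\<close> dominates \<open>x\<close> and kills the link
        between them. The other link alone does not lead in and out of \<open>H\<close>, and outside
        \<open>H\<close> only \<open>v\<close> and two neighbours remain.\<close>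
      obtain D where D: "isolates H D" "z \<in> D" "6 * card D = m H + 1"
        using extremal_through[OF HS(4)[OF H(1)] ex H(2)] by blast
      have xD: "x \<in> N D" using D(2) zx by (auto simp: N_iff)
      have zxb: "{z, x} \<in> crossing H X" using H(2) zx x(1) by (auto intro!: crossingI simp: X_def)
      have "isolates S D"
        unfolding isolates_def
      proof (intro conjI allI impI)
        show "D \<subseteq> S" using D(1) HS(3)[OF H(1)] unfolding isolates_def by blast
        fix C assume C: "cycle_set 4 C" "C \<subseteq> S"
        show "C \<inter> N D \<noteq> {}"
        proof
          assume C0: "C \<inter> N D = {}"
          hence xC: "x \<notin> C" using xD by blast
          have "C \<subseteq> H \<or> C \<inter> H = {}"
          proof (rule cycle_set_separated[OF cycle_set_mono[OF C(1)]])
            show "card (crossing H X - {{z, x}}) \<le> 1" using dH zxb by (simp add: d_def)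
            have "crossing (C \<inter> H) (C - H) \<subseteq> crossing H X"
              unfolding bdH[OF H(1), symmetric] using C(2) by (intro crossing_mono) auto
            moreover have "{z, x} \<notin> crossing (C \<inter> H) (C - H)" using xC by (auto simp: crossing_def doubleton_eq_iff)
            ultimately show "crossing (C \<inter> H) (C - H) \<subseteq> crossing H X - {{z, x}}" by blast
          qed auto
          thus False
          proof
            assume "C \<subseteq> H" thus False using isolatesD[OF D(1) C(1)] C0 by blast
          next
            assume "C \<inter> H = {}"
            hence "C \<subseteq> insert v (A - {x})" using C(2) SH xC by (auto simp: X_def)
            thus False using no_long_cycle_if_small[OF Ax(2,1)] C(1) by blast
          qed
        qed
      qed
      moreover have "6 * card D \<le> m S" using D(3) mS dH by simp
      ultimately show False using nvg unfolding slack_def by blast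
    next
      assume sqH: "square H"
      \<comment> \<open>\<open>z\<close> dominates \<open>x\<close> and the square up to
        \<open>q\<close>. Since \<open>q\<close> already has the dominated neighbours
        \<open>p\<close> and \<open>r\<close>, the degree bound leaves it too few edges to lie on a
        surviving cycle.\<close>
      obtain p q r where h: "H = {z, p, q, r}" "distinct [z, p, q, r]"
        "{z, p} \<in> E" "{z, r} \<in> E" "{q, p} \<in> E" "{q, r} \<in> E" by (rule square_vertex[OF sqH H(2)])
      have Nz: "p \<in> N {z}" "r \<in> N {z}" "z \<in> N {z}" "x \<in> N {z}" using h zx by (auto simp: N_iff)
      have "isolates S {z}"
        unfolding isolates_def
      proof (intro conjI allI impI)
        show "{z} \<subseteq> S" using z(1) by simp
        fix C assume C: "cycle_set 4 C" "C \<subseteq> S"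
        show "C \<inter> N {z} \<noteq> {}"
        proof
          assume C0: "C \<inter> N {z} = {}"
          hence CN: "p \<notin> C" "r \<notin> C" "z \<notin> C" "x \<notin> C" using Nz by auto
          have CS: "C \<subseteq> insert q (insert v (A - {x}))" using C(2) SH h(1) CN by (auto simp: X_def)
          have qC: "q \<in> C"
          proof (rule ccontr)
            assume "q \<notin> C"
            hence "C \<subseteq> insert v (A - {x})" using CS by auto
            thus False using no_long_cycle_if_small[OF Ax(2,1)] C(1) by blast
          qed
          obtain y1 y2 where y: "y1 \<noteq> y2" "y1 \<in> C" "y2 \<in> C" "{q, y1} \<in> E" "{q, y2} \<in> E"
            by (rule cycle_set_degree[OF cycle_set_mono[OF C(1)] qC]) simp
          have pS: "p \<in> S" "r \<in> S" "q \<in> S" using h(1) HS(3)[OF H(1)] by auto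
          have "{p, r, y1, y2} \<subseteq> nbrs S q" using y h pS C(2) by (auto simp: nbrs_def)
          moreover have "finite (nbrs S q)" using fS by (simp add: nbrs_def)
          ultimately have "card {p, r, y1, y2} \<le> card (nbrs S q)" by (rule card_mono[rotated])
          moreover have "card {p, r, y1, y2} = 4" using y(1,2,3) CN h(2) by (auto simp: card_insert_if)
          ultimately show False using deg3[OF pS(3)] by simp
        qed
      qed
      moreover have "6 * card {z} \<le> m S" using mS mX cA square_card_edges[OF HS(4)[OF H(1)] sqH] by simp
      ultimately show False using nvg unfolding slack_def by blast
    qed
  next
    case 1
    hence e0: "edges_in A = {}" by simp
    have "slack S"
    proof (rule cheap_union[OF S(1) XS(1) P])
      show "\<not> C \<subseteq> X" if "cycle_set 3 C" for C using star_acyclic[OF e0 that] by (simp add: X_def)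
      fix H assume H: "H \<in> P"
      have gH: "g H \<le> 2" using gle[OF H] gtot by simp
      have d2': "2 \<le> card (crossing H X)" using d2[OF H] by (simp add: d_def)
      \<comment> \<open>A slack component would have exactly two links, exhaust the budget and be
        the only one; but the three independent vertices of \<open>A\<close> need at least three
        links.\<close>
      have "\<not> slack H"
      proof
        assume "slack H"
        hence "d H = g H" by (simp add: g_def)
        hence g2: "g H = 2" "(\<Sum>H\<in>P. g H) = 2" using d2[OF H] gle[OF H] gtot by auto
        have "(\<Sum>H\<in>P. g H) = g H + (\<Sum>H\<in>P - {H}. g H)" using fP H by (simp add: sum.remove)
        hence s0: "(\<Sum>H\<in>P - {H}. g H) = 0" using g2 by simp
        have "P - {H} = {}"
        proof (rule ccontr)
          assume "P - {H} \<noteq> {}"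
          then obtain H' where H': "H' \<in> P - {H}" by blast
          hence "g H' = 0" using s0 fP by simp
          thus False using g1(1)[of H'] H' by simp
        qed
        hence "P = {H}" using H by auto
        hence "card A \<le> d H" using k1 1 by simp
        thus False using cA g2 \<open>d H = g H\<close> by simp
      qed
      then consider "square H" | "extremal H" "\<not> slack H" using kinds[OF H] by blast
      thus "\<exists>D. isolates H D \<and> card {e \<in> crossing H X. e \<inter> N D = {}} \<le> 1 \<and> 6 * card D \<le> m H + card (crossing H X)"
      proof cases
        case 1
        show ?thesis by (rule cheap_square[OF S(1) XS(1) HS(1)[OF H] deg3 1 d2'])
      next
        case 2
        \<comment> \<open>The budget excludes extremal components with more than three
          links.\<close>
        hence "d H - 1 \<le> 2" using gH by (simp add: g_def)
        then consider "card (crossing H X) = 2" | "card (crossing H X) = 3" using d2' unfolding d_def by linarith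
        thus ?thesis
        proof cases
          case 1
          show ?thesis by (rule cheap_extremal_two[OF S(1) _ 2(1) 1]) (use HS(3)[OF H] in auto)
        next
          case c3: 2
          show ?thesis
            by (rule cheap_extremal_three[OF S(1) XS(1) HS(1)[OF H] XS(2) S(4) deg3 nosq 2(1) c3 bdH[OF H]])
        qed
      qed
    qed
    thus False using nvg by simp
  qed
qed

section \<open>The induction over connected vertex sets\<close>

theorem square_or_isolated_or_extremal:
  assumes "S \<subseteq> V" "conn S"
  shows "square S \<or> slack S \<or> extremal S"
  using assms
proof (induction "card S" arbitrary: S rule: less_induct)
  case less
  have fS: "finite S" using less.prems(1) finite_sub by blast
  have ok: "smaller_ok S"
    unfolding smaller_ok_def
  proof (intro allI impI)
    fix R assume "R \<subset> S" "conn R"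
    thus "square R \<or> slack R \<or> extremal R" using less.hyps[of R] less.prems(1) psubset_card_mono[OF fS] by auto
  qed
  show ?case
  proof (cases "bridgeless S")
    case False
    thus ?thesis using bridge_case[OF less.prems ok] by blast
  next
    case True
    have "S \<noteq> {}" using less.prems(2) by (simp add: conn_def)
    hence "Max ((\<lambda>z. card (nbrs S z)) ` S) \<in> (\<lambda>z. card (nbrs S z)) ` S" using fS by (intro Max_in) auto
    then obtain v where v: "v \<in> S" "card (nbrs S v) = Max ((\<lambda>z. card (nbrs S z)) ` S)" by auto
    have vmax: "card (nbrs S z) \<le> card (nbrs S v)" if "z \<in> S" for z
      unfolding v(2) using fS that by (intro Max_ge) auto
    show ?thesis
    proof (cases "3 \<le> card (nbrs S v)")
      case v3: True
      show ?thesis using max_degree_ge_three_case[OF less.prems ok True v(1) v3 vmax] by blast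
    next
      case False
      show ?thesis
      proof (rule max_degree_two_case[OF less.prems])
        fix z assume "z \<in> S"
        thus "card (nbrs S z) \<le> 2" using vmax[of z] False by simp
      qed
    qed
  qed
qed

section \<open>The isolation number\<close>

lemma edges_in_V [simp]: "edges_in V = E" using edge_V by (auto simp: edges_in_def)

lemma induced_V [simp]: "induced V = G" by (simp add: induced_def)

section \<open>Agreement with the given notions of connectedness, isolation and special
  graphs\<close>

lemma connected_conn:
  assumes "connected_graph G" shows "conn V"
  unfolding conn_def
proof (intro conjI allI impI)
  show "V \<noteq> {}" using assms by (simp add: connected_graph_def)
  fix X assume X: "X \<subseteq> V" "X \<noteq> {}" "X \<noteq> V"
  then obtain x y where xy: "x \<in> X" "y \<in> V - X" by blast
  have "(x, y) \<in> {(x, y). {x, y} \<in> E}\<^sup>*" using assms xy X(1) by (auto simp: connected_graph_def)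
  \<comment> \<open>Along a path from \<open>x\<close>, the first step out of \<open>X\<close> is a
    crossing edge.\<close>
  hence "y \<in> X \<or> crossing X (V - X) \<noteq> {}"
  proof induction
    case base thus ?case using xy by simp
  next
    case (step y z)
    show ?case
    proof (cases "y \<in> X \<and> z \<notin> X")
      case True
      have e: "{y, z} \<in> E" using step by simp
      hence "z \<in> V" using edge_V by blast
      thus ?thesis using crossingI[OF e, of X "V - X"] True by auto
    qed (use step in auto)
  qed
  thus "crossing X (V - X) \<noteq> {}" using xy by simp
qed

lemma conn_connected:
  assumes "conn T" shows "connected_graph (induced T)"
  unfolding connected_graph_def
proof (intro conjI ballI)
  show "verts (induced T) \<noteq> {}" using assms by (simp add: conn_def)
  fix u v assume uv: "u \<in> verts (induced T)" "v \<in> verts (induced T)"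
  define Z where "Z = {z \<in> T. (u, z) \<in> {(x, y). {x, y} \<in> edges (induced T)}\<^sup>*}"
  have "Z = T"
  proof (rule ccontr)
    assume "Z \<noteq> T"
    moreover have "Z \<subseteq> T" "u \<in> Z" using uv by (auto simp: Z_def)
    ultimately obtain x y where xy: "x \<in> Z" "y \<in> T - Z" "{x, y} \<in> E"
      using conn_cut[OF assms, of Z] by blast
    hence "(x, y) \<in> {(x, y). {x, y} \<in> edges (induced T)}" by (simp add: in_edges_in Z_def)
    hence "y \<in> Z" using xy by (auto simp: Z_def intro: rtrancl_into_rtrancl)
    thus False using xy by simp
  qed
  thus "(u, v) \<in> {(x, y). {x, y} \<in> edges (induced T)}\<^sup>*" using uv by (auto simp: Z_def)
qed

text \<open>A subgraph whose vertices avoid \<open>X\<close> has no edge meeting \<open>X\<close>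
  either, so a cycle survives the deletion of \<open>X\<close> if and only if its vertex set is
  disjoint from \<open>X\<close>.\<close>

lemma isolating_iff_isolates: "isolating_set G long_cycles D \<longleftrightarrow> isolates V D"
proof -
  have "contains_family long_cycles (delete_verts G X) \<longleftrightarrow> (\<exists>C. cycle_set 4 C \<and> C \<inter> X = {})" for X
  proof
    assume "contains_family long_cycles (delete_verts G X)"
    then obtain K n where "subgraph_of K (delete_verts G X)" "graph_iso K (cycle_graph n)" "n \<ge> 4"
      by (auto simp: contains_family_def long_cycles_def)
    hence "cycle_set 4 (verts K)" "verts K \<inter> X = {}"
      by (auto simp: cycle_set_def subgraph_of_def delete_verts_def)
    thus "\<exists>C. cycle_set 4 C \<and> C \<inter> X = {}" by blast
  next
    assume "\<exists>C. cycle_set 4 C \<and> C \<inter> X = {}"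
    then obtain K n where K: "subgraph_of K G" "verts K \<inter> X = {}" "graph_iso K (cycle_graph n)" "n \<ge> 4"
      by (auto simp: cycle_set_def)
    have "e \<inter> X = {}" if "e \<in> edges K" for e
    proof -
      have "e \<subseteq> verts K" using K(1) that by (simp add: subgraph_of_def simple_graph_def)
      thus ?thesis using K(2) by blast
    qed
    hence "subgraph_of K (delete_verts G X)" using K(1,2) by (auto simp: subgraph_of_def delete_verts_def)
    thus "contains_family long_cycles (delete_verts G X)"
      using K(3,4) by (auto simp: contains_family_def long_cycles_def)
  qed
  hence "isolating_set G long_cycles D \<longleftrightarrow> D \<subseteq> V \<and> (\<forall>C. cycle_set 4 C \<longrightarrow> C \<inter> N D \<noteq> {})"
    by (auto simp: isolating_set_def)
  also have "\<dots> \<longleftrightarrow> isolates V D" using cycle_set_sub by (auto simp: isolates_def)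
  finally show ?thesis .
qed

text \<open>The tree vertices are numbered arbitrarily. The remainder graph is the single vertex
  \<open>v q\<close>, and \<open>r = 0\<close> because \<open>card E + 1\<close> is a multiple of
  six.\<close>

lemma pure_special_pure:
  assumes p: "pure_special V T F w"
  shows "pure_C4_special (card E) G"
proof -
  define q where "q = card T"
  have TV: "T \<subseteq> V" using pure_special_sub[OF p] .
  have fT: "finite T" using TV finite_sub by blast
  have mq: "card E + 1 = 6 * q" using pure_specialD(8)[OF p] by (simp add: q_def)
  obtain v where v: "bij_betw v {1..q} T" using ex_bij_betw_nat_finite_1[OF fT] q_def by blast
  have vT: "v ` {1..q} = T" "inj_on v {1..q}" using v by (auto simp: bij_betw_def)
  have vi: "v i \<in> T" if "i \<in> {1..q}" for i using that vT(1) by blast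
  have q1: "q \<ge> 1" using pure_specialD(1)[OF p] fT by (simp add: q_def Suc_le_eq card_gt_0_iff)
  hence qq: "q \<in> {1..q}" by simp
  define T' where "T' = \<lparr>verts = {v q}, edges = ({} :: 'a set set)\<rparr>"
  let ?F = "\<lambda>i. induced (F (v i))" and ?w = "\<lambda>i. w (v i)"
  have "special_decomposition q 0 G v ?F ?w (induced T) T'"
    unfolding special_decomposition_def
  proof (intro conjI ballI impI)
    show "q \<ge> 1" "inj_on v {1..q}" using q1 vT(2) .
    show "simple_graph (?F i)" if "i \<in> {1..q}" for i
      by (rule simple_induced[OF pure_special_F_sub[OF p vi[OF that]]])
    show "graph_iso (?F i) (cycle_graph 4)" if "i \<in> {1..q}" for i using pure_special_sq[OF p vi[OF that]] .
    show "verts (?F i) \<inter> v ` {1..q} = {}" if "i \<in> {1..q}" for i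
      unfolding vT(1) induced_simps by (rule pure_special_T[OF p vi[OF that]])
    show "?w i \<in> verts (?F i)" if "i \<in> {1..q}" for i
      unfolding induced_simps by (rule pure_special_w[OF p vi[OF that]])
    show "verts (?F i) \<inter> verts (?F j) = {}" if "i \<in> {1..q}" "j \<in> {1..q}" "i \<noteq> j" for i j
    proof -
      have "v i \<noteq> v j" using inj_onD[OF vT(2) _ that(1,2)] that(3) by blast
      thus ?thesis unfolding induced_simps by (rule pure_special_disj[OF p vi[OF that(1)] vi[OF that(2)]])
    qed
    have "\<not> contains_family {cycle_graph n |n. 3 \<le> n} (induced T)"
    proof
      assume "contains_family {cycle_graph n |n. 3 \<le> n} (induced T)"
      then obtain K n where K: "subgraph_of K (induced T)" "graph_iso K (cycle_graph n)" "n \<ge> 3"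
        by (auto simp: contains_family_def)
      hence "cycle_set 3 (verts K)" using TV by (auto simp: cycle_set_def subgraph_of_def edges_in_def)
      moreover have "verts K \<subseteq> T" using K(1) by (simp add: subgraph_of_def)
      ultimately show False using pure_specialD(6)[OF p] by blast
    qed
    thus "tree (induced T)" using simple_induced[OF TV] conn_connected[OF pure_specialD(3)[OF p]] by (simp add: tree_def)
    show "verts (induced T) = v ` {1..q}" using vT(1) by simp
    show "simple_graph T'" "connected_graph T'" "card (edges T') = 0"
      by (simp_all add: T'_def simple_graph_def connected_graph_def)
    show "verts T' \<inter> (\<Union>i\<in>{1..q}. verts (constituent (v i) (?F i) (?w i))) = {v q}"
      using qq by (auto simp: T'_def constituent_def)
    have "(\<Union>i\<in>{1..q}. verts (constituent (v i) (?F i) (?w i))) = (\<Union>t\<in>v ` {1..q}. insert t (F t))"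
      by (auto simp: constituent_def)
    also have "\<dots> = V" unfolding vT(1) using pure_specialD(2)[OF p] by auto
    finally show "V = verts T' \<union> (\<Union>i\<in>{1..q}. verts (constituent (v i) (?F i) (?w i)))"
      using vi[OF qq] TV by (auto simp: T'_def)
    have "(\<Union>i\<in>{1..q}. edges (constituent (v i) (?F i) (?w i))) =
        (\<Union>t\<in>v ` {1..q}. insert {t, w t} (edges_in (F t)))"
      by (auto simp: constituent_def)
    thus "E = edges (induced T) \<union> edges T' \<union> (\<Union>i\<in>{1..q}. edges (constituent (v i) (?F i) (?w i)))"
      unfolding vT(1) using pure_specialD(7)[OF p] by (simp add: T'_def)
  qed
  moreover have "(card E + 1) div 6 = q" "(card E + 1) mod 6 = 0" using mq by simp_all
  ultimately show ?thesis unfolding pure_C4_special_def by (metis T'_def ugraph.select_convs(2))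
qed

text \<open>The neighbours of a vertex of \<open>F i\<close> all lie in \<open>B i\<close>, since
  the tree and the remainder graph avoid the squares. So dominating a vertex of \<open>F i\<close>
  takes a vertex of \<open>B i\<close>, and these sets are disjoint.\<close>

lemma special_lower_bound:
  assumes s: "special_decomposition q r G v F w T T'" and D: "isolates V D"
  shows "q \<le> card D"
proof -
  note s' = s[unfolded special_decomposition_def]
  have inj: "inj_on v {1..q}" and F: "\<forall>i\<in>{1..q}. simple_graph (F i) \<and> graph_iso (F i) (cycle_graph 4) \<and>
        verts (F i) \<inter> v ` {1..q} = {} \<and> w i \<in> verts (F i)"
    and disj: "\<forall>i\<in>{1..q}. \<forall>j\<in>{1..q}. i \<noteq> j \<longrightarrow> verts (F i) \<inter> verts (F j) = {}"
    and T: "tree T" "verts T = v ` {1..q}" and T': "simple_graph T'"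
    "verts T' \<inter> (\<Union>i\<in>{1..q}. verts (constituent (v i) (F i) (w i))) = {v q}"
    and Veq: "V = verts T' \<union> (\<Union>i\<in>{1..q}. verts (constituent (v i) (F i) (w i)))"
    and Eeq: "E = edges T \<union> edges T' \<union> (\<Union>i\<in>{1..q}. edges (constituent (v i) (F i) (w i)))"
    and q1: "q \<ge> 1"
    by (rule s'[elim_format], elim conjE, assumption)+
  have fD: "finite D" "D \<subseteq> V" using D finite_sub by (auto simp: isolates_def)
  have Fs: "simple_graph (F i)" "graph_iso (F i) (cycle_graph 4)" "w i \<in> verts (F i)"
    and Fv: "verts (F i) \<inter> v ` {1..q} = {}" if "i \<in> {1..q}" for i
    using bspec[OF F that] by simp_all
  have Fdisj: "verts (F i) \<inter> verts (F j) = {}" if "i \<in> {1..q}" "j \<in> {1..q}" "i \<noteq> j" for i j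
    using bspec[OF bspec[OF disj that(1)] that(2)] that(3) by simp
  define B where "B i = insert (v i) (verts (F i))" for i
  have Bdisj: "B i \<inter> B j = {}" if "i \<in> {1..q}" "j \<in> {1..q}" "i \<noteq> j" for i j
  proof -
    have "v i \<noteq> v j" using inj_onD[OF inj _ that(1,2)] that(3) by blast
    moreover have "verts (F i) \<inter> verts (F j) = {}" by (rule Fdisj[OF that])
    moreover have "v i \<notin> verts (F j)" "v j \<notin> verts (F i)"
      using Fv[OF that(2)] Fv[OF that(1)] that(1,2) by blast+
    ultimately show ?thesis by (auto simp: B_def)
  qed
  have hit: "D \<inter> B i \<noteq> {}" if i: "i \<in> {1..q}" for i
  proof -
    note Fi = Fs(1)[OF i] Fs(2)[OF i] Fv[OF i]
    have sub: "verts (F i) \<subseteq> (\<Union>i\<in>{1..q}. verts (constituent (v i) (F i) (w i)))"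
      using i by (auto simp: constituent_def)
    have "edges (F i) \<subseteq> (\<Union>i\<in>{1..q}. edges (constituent (v i) (F i) (w i)))"
      using i by (auto simp: constituent_def)
    hence "edges (F i) \<subseteq> E" by (subst Eeq) (rule le_supI2)
    moreover have "verts (F i) \<subseteq> V" using sub by (subst Veq) (rule le_supI2)
    ultimately have "subgraph_of (F i) G" using Fi(1) by (simp add: subgraph_of_def)
    hence "cycle_set 4 (verts (F i))" using Fi(2) unfolding cycle_set_def by blast
    moreover have "verts (F i) \<subseteq> V" using cycle_set_sub[OF calculation] .
    ultimately obtain u where u: "u \<in> verts (F i)" "u \<in> N D" using isolatesD[OF D] by blast
    have uv: "u \<notin> v ` {1..q}" using u(1) Fi(3) by blast
    show ?thesis
    proof (cases "u \<in> D")
      case True thus ?thesis using u(1) by (auto simp: B_def)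
    next
      case False
      then obtain d where d: "d \<in> D" "{d, u} \<in> E" using u(2) by (auto simp: N_iff)
      consider "{d, u} \<in> edges T" | "{d, u} \<in> edges T'" |
        j where "j \<in> {1..q}" "{d, u} \<in> edges (constituent (v j) (F j) (w j))"
        using d(2) by (subst (asm) Eeq) blast
      hence "d \<in> B i"
      proof cases
        case 1
        hence "u \<in> verts T" using T(1) by (auto simp: tree_def simple_graph_def)
        thus ?thesis using uv T(2) by simp
      next
        case 2
        hence "u \<in> verts T'" using T'(1) by (auto simp: simple_graph_def)
        \<comment> \<open>The remainder graph touches the constituents only in \<open>v q\<close>,
          which lies on no square.\<close>
        hence "u = v q" using T'(2) u(1) sub by blast
        thus ?thesis using uv q1 by auto
      next
        case (3 j)
        note wj = Fs(3)[OF 3(1)] Fs(1)[OF 3(1)]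
        from 3(2) consider "{d, u} \<in> edges (F j)" | "{d, u} = {v j, w j}" by (auto simp: constituent_def)
        thus ?thesis
        proof cases
          case 1
          hence du: "d \<in> verts (F j)" "u \<in> verts (F j)" using wj(2) by (auto simp: simple_graph_def)
          hence "i = j" using Fdisj[OF i 3(1)] u(1) by blast
          thus ?thesis using du by (simp add: B_def)
        next
          case 2
          hence "u = w j" "d = v j" using uv 3(1) by (auto simp: doubleton_eq_iff)
          moreover from this have "i = j" using Fdisj[OF i 3(1)] u(1) wj(1) by blast
          ultimately show ?thesis by (simp add: B_def)
        qed
      qed
      thus ?thesis using d(1) by blast
    qed
  qed
  have "q = (\<Sum>i\<in>{1..q}. 1)" by simp
  also have "\<dots> \<le> (\<Sum>i\<in>{1..q}. card (D \<inter> B i))"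
  proof (rule sum_mono)
    fix i assume "i \<in> {1..q}"
    hence "card (D \<inter> B i) \<noteq> 0" using hit[of i] fD(1) by simp
    thus "1 \<le> card (D \<inter> B i)" by linarith
  qed
  also have "\<dots> = card (\<Union>i\<in>{1..q}. D \<inter> B i)"
  proof (rule card_UN_disjoint[symmetric])
    show "\<forall>i\<in>{1..q}. \<forall>j\<in>{1..q}. i \<noteq> j \<longrightarrow> (D \<inter> B i) \<inter> (D \<inter> B j) = {}" using Bdisj by blast
  qed (use fD(1) in auto)
  also have "\<dots> \<le> card D" using fD(1) by (intro card_mono) auto
  finally show ?thesis .
qed

text \<open>A pentagon is such a cycle itself; a diamond contains a spanning one, obtained by
  dropping the chord, the edge mapped to \<open>{1, 3}\<close>.\<close>

lemma diamond_pentagon_cycle: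
  assumes "diamond V \<or> pentagon V" shows "cycle_set 4 V"
  using assms
proof
  assume "pentagon V"
  moreover have "subgraph_of G G" using simple by (simp add: subgraph_of_def)
  ultimately show ?thesis unfolding cycle_set_def by (intro exI[of _ G] exI[of _ 5]) simp
next
  assume "diamond V"
  then obtain f where f0: "bij_betw f V (verts diamond_graph)"
    "\<forall>u\<in>V. \<forall>w\<in>V. {u, w} \<in> E \<longleftrightarrow> {f u, f w} \<in> edges diamond_graph"
    unfolding graph_iso_def induced_V by blast
  have f: "bij_betw f V {1, 2, 3, 4}"
    "\<And>u w. u \<in> V \<Longrightarrow> w \<in> V \<Longrightarrow> {u, w} \<in> E \<longleftrightarrow> {f u, f w} \<in> edges diamond_graph"
    using f0(1) bspec[OF bspec[OF f0(2)]] by (simp_all add: diamond_graph_def)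
  define K where "K = \<lparr>verts = V, edges = {e \<in> E. f ` e \<noteq> {1, 3}}\<rparr>"
  have "subgraph_of K G" using simple by (auto simp: subgraph_of_def K_def simple_graph_def)
  moreover have "graph_iso K (cycle_graph 4)"
    unfolding graph_iso_def
  proof (intro exI[of _ f] conjI ballI)
    have "{1..4} = {1, 2, 3, 4::nat}" by auto
    thus "bij_betw f (verts K) (verts (cycle_graph 4))" using f(1) by (simp add: K_def)
    fix u w assume "u \<in> verts K" "w \<in> verts K"
    hence "{u, w} \<in> edges K \<longleftrightarrow> {f u, f w} \<in> edges diamond_graph \<and> {f u, f w} \<noteq> {1, 3}"
      using f(2)[of u w] by (simp add: K_def)
    also have "\<dots> \<longleftrightarrow> {f u, f w} \<in> edges (cycle_graph 4)"
      unfolding cycle_graph_4 by (auto simp: diamond_graph_def doubleton_eq_iff)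
    finally show "{u, w} \<in> edges K \<longleftrightarrow> {f u, f w} \<in> edges (cycle_graph 4)" .
  qed
  ultimately show ?thesis unfolding cycle_set_def by (intro exI[of _ K] exI[of _ 4]) (simp add: K_def)
qed

lemma diamond_pentagon_lower_bound:
  assumes "diamond V \<or> pentagon V" "isolates V D" shows "1 \<le> card D"
proof -
  have "D \<noteq> {}" using isolatesD[OF assms(2) diamond_pentagon_cycle[OF assms(1)]] by auto
  moreover have "finite D" using assms(2) finite_sub by (auto simp: isolates_def)
  ultimately show ?thesis by (simp add: Suc_le_eq card_gt_0_iff)
qed

section \<open>The minimum itself, compared with the number of edges\<close>

lemma isolation_number_props:
  assumes "isolates V D0"
  obtains D where "isolates V D" "card D = isolation_number G long_cycles"
    "isolation_number G long_cycles \<le> card D0"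
proof -
  have ex: "\<exists>k D. isolating_set G long_cycles D \<and> card D = k" using assms isolating_iff_isolates by blast
  have "\<exists>D. isolating_set G long_cycles D \<and> card D = isolation_number G long_cycles"
    unfolding isolation_number_def by (rule LeastI_ex[OF ex])
  moreover have "isolation_number G long_cycles \<le> card D0"
    unfolding isolation_number_def using assms isolating_iff_isolates by (intro Least_le) blast
  ultimately show ?thesis using that isolating_iff_isolates by blast
qed

text \<open>Multiplying by six keeps everything in the natural numbers. Equality rules out slack, so
  that the graph is extremal; conversely each kind of extremal graph has its own lower
  bound.\<close>

lemma isolation_dichotomy:
  assumes "connected_graph G" "\<not> graph_iso G (cycle_graph 4)"
  shows "6 * isolation_number G long_cycles \<le> card E + 1"
    and "6 * isolation_number G long_cycles = card E + 1 \<longleftrightarrow>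
      pure_C4_special (card E) G \<or> graph_iso G diamond_graph \<or> graph_iso G (cycle_graph 5)"
    and "special_decomposition q r G v F w T T' \<Longrightarrow> q \<le> isolation_number G long_cycles"
proof -
  let ?i = "isolation_number G long_cycles"
  let ?X = "pure_C4_special (card E) G \<or> graph_iso G diamond_graph \<or> graph_iso G (cycle_graph 5)"
  have main: "slack V \<or> extremal V"
    using square_or_isolated_or_extremal[OF _ connected_conn[OF assms(1)]] assms(2) by simp
  obtain D0 where D0: "isolates V D0" "6 * card D0 \<le> card E + 1" using slack_extremal_isolates[OF _ main] by auto
  obtain D where D: "isolates V D" "card D = ?i" "?i \<le> card D0" by (rule isolation_number_props[OF D0(1)])
  show le: "6 * ?i \<le> card E + 1" using D(3) D0(2) by simp
  show low: "q \<le> ?i" if "special_decomposition q r G v F w T T'" for q r v F w T T'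
    using special_lower_bound[OF that D(1)] D(2) by simp
  show "6 * ?i = card E + 1 \<longleftrightarrow> ?X"
  proof
    assume eq: "6 * ?i = card E + 1"
    have "\<not> slack V"
    proof
      assume "slack V"
      then obtain D1 where D1: "isolates V D1" "6 * card D1 \<le> card E" unfolding slack_def by auto
      have "?i \<le> card D1" by (rule isolation_number_props[OF D1(1)])
      thus False using D1(2) eq by simp
    qed
    hence "extremal V" using main by simp
    thus ?X using pure_special_pure unfolding extremal_def by auto
  next
    assume ?X
    hence "card E + 1 \<le> 6 * ?i"
    proof (elim disjE)
      assume "pure_C4_special (card E) G"
      then obtain v F w T T' where
        s: "special_decomposition ((card E + 1) div 6) ((card E + 1) mod 6) G v F w T T'" "edges T' = {}"
        unfolding pure_C4_special_def by blast
      \<comment> \<open>The remainder graph has no edges, so the lower bound by the number of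
        constituents loses nothing to rounding.\<close>
      have "(card E + 1) mod 6 = 0" using s by (simp add: special_decomposition_def)
      thus ?thesis using low[OF s(1)] by presburger
    next
      assume d: "graph_iso G diamond_graph"
      thus ?thesis using diamond_pentagon_lower_bound[OF _ D(1)] D(2) diamond_card_edges[of V] by simp
    next
      assume d: "graph_iso G (cycle_graph 5)"
      thus ?thesis using diamond_pentagon_lower_bound[OF _ D(1)] D(2) pentagon_card_edges[of V] by simp
    qed
    thus "6 * ?i = card E + 1" using le by simp
  qed
qed


end

theorem theorem1p4:
  fixes G :: "'a ugraph" and m :: nat
  assumes "simple_graph G"
    and "connected_graph G"
    and "card (edges G) = m"
    and "\<not> graph_iso G (cycle_graph 4)"
  shows "real (isolation_number G long_cycles) \<le> (real m + 1) / 6 \<and>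
    (real (isolation_number G long_cycles) = (real m + 1) / 6 \<longleftrightarrow>
       pure_C4_special m G \<or> graph_iso G diamond_graph \<or> graph_iso G (cycle_graph 5)) \<and>
    (C4_special m G \<longrightarrow>
       int (isolation_number G long_cycles) = \<lfloor>(real m + 1) / 6\<rfloor>)"
proof -
  define i where "i = isolation_number G long_cycles"
  have fg: "fin_graph G" using assms(1) by (simp add: fin_graph_def)
  note dich = fin_graph.isolation_dichotomy[OF fg assms(2,4), unfolded assms(3), folded i_def]
  have le: "6 * real i \<le> real m + 1" using dich(1) by linarith
  have eq: "real i = (real m + 1) / 6 \<longleftrightarrow> 6 * i = m + 1"
  proof -
    have "real i = (real m + 1) / 6 \<longleftrightarrow> real (6 * i) = real (m + 1)" by auto
    thus ?thesis by (simp only: of_nat_eq_iff)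
  qed
  have "int i = \<lfloor>(real m + 1) / 6\<rfloor>" if special: "C4_special m G"
  proof -
    \<comment> \<open>Without constituents there is nothing to show; otherwise each of them costs a
      vertex. The general upper bound supplies the converse inequality.\<close>
    have "(m + 1) div 6 \<le> i"
    proof (cases "(m + 1) div 6 = 0")
      case False
      then obtain v F w T T' where
        "special_decomposition ((m + 1) div 6) ((m + 1) mod 6) G v F w T T'"
        using special unfolding C4_special_def Let_def by auto
      thus ?thesis by (rule dich(3))
    qed simp
    hence "i = (m + 1) div 6" using dich(1) by linarith
    moreover have "\<lfloor>(real m + 1) / 6\<rfloor> = int ((m + 1) div 6)"
      using floor_divide_of_nat_eq[of "m + 1" 6, where ?'a = real] by (simp add: add.commute)
    ultimately show ?thesis by simp
  qed
  thus ?thesis using le eq dich(2) unfolding i_def by auto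
qed

end
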